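(* Let $0<\rho<1$ and $M=4$ (so $N=8$). For $x\in\{s,a\}$ let $\lambda^{(x)}_0<\dots<\lambda^{(x)}_3$ be $$(\lambda^{(s)}_j)=(0,\;2-\sqrt2,\;2,\;2+\sqrt2),\qquad(\lambda^{(a)}_j)=\Big(2-\sqrt{2+\sqrt2},\;2-\sqrt{2-\sqrt2},\;2+\sqrt{2-\sqrt2},\;2+\sqrt{2+\sqrt2}\Big),$$ put $d^{(x)}_j=\rho\lambda^{(x)}_j+(1-\rho)^2$, $q^{(s)}=\mathbf{C}^{\mathrm{II}}_4e_0$, $q^{(a)}=\mathbf{C}^{\mathrm{IV}}_4e_0$, and let $\mathbf{G}^{(x)}_4=\mathrm{diag}(d^{(x)}_0,\dots,d^{(x)}_3)+\rho(1-\rho)\,q^{(x)}(q^{(x)})^T$. Let $\mathbf{Q}^{(x)}_4$ be the orthogonal matrix whose rows are the unit eigenvectors of $\mathbf{G}^{(x)}_4$, ordered by increasing eigenvalue. Then: (1) $(q^{(s)}_j)^2=\beta_j^2\,\frac{4-\lambda^{(s)}_j}{8}$ with $\beta_0=1/\sqrt2$ and $\beta_j=1$ for $j\ge1$, and $(q^{(a)}_j)^2=\frac{4-\lambda^{(a)}_j}{8}$. (2) Let $$p(\mu;\rho)=\mu^4-(4-\rho+3\rho^2)\mu^3+(6-3\rho+6\rho^2-2\rho^3+3\rho^4)\mu^2-(4-3\rho+3\rho^2-2\rho^3+2\rho^4-\rho^5+\rho^6)\mu+(1-\rho).$$ The characteristic polynomial of $\mathbf{G}^{(s)}_4$ is $p(\mu;\rho)$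 and that of $\mathbf{G}^{(a)}_4$ is $p(\mu;-\rho)$. (3) If $\mu_0<\dots<\mu_3$ are the eigenvalues of $\mathbf{G}^{(x)}_4$, then, up to the overall sign of each row, $$\big[\mathbf{Q}^{(x)}_4\big]_{ij}=\frac{q^{(x)}_j}{d^{(x)}_j-\mu_i}\left(\sum_{k=0}^{3}\frac{(q^{(x)}_k)^2}{(d^{(x)}_k-\mu_i)^2}\right)^{-1/2},\qquad i,j=0,\dots,3.$$ (4) $\mathbf{Q}^{(x)}_4=G_1G_2G_3G_4G_5G_6\,\mathbf{S}_x$, where $\mathbf{S}_x$ is a diagonal matrix with entries $\pm1$ and $G_k$, $k=1,\dots,6$, is a Givens rotation by some angle $\theta_k$ in the coordinate plane $(0,1),(0,2),(0,3),(1,2),(1,3),(2,3)$, respectively. (5) All the entries of $\mathbf{Q}^{(x)}_4$, and all of the numbers $\cos\theta_k,\sin\theta_k$ (for suitable $\theta_k$ in (4)), are expressible in radicals in $\rho$.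
   Context: All indices start at $0$. $\mathbf{C}^{\mathrm{II}}_4$ and $\mathbf{C}^{\mathrm{IV}}_4$ are the orthonormal DCT-II and DCT-IV matrices of order $4$: $[\mathbf{C}^{\mathrm{II}}_4]_{n,k}=\sqrt{1/2}\,\beta_n\cos\frac{\pi n(2k+1)}{8}$ with $\beta_0=1/\sqrt2$, $\beta_n=1$ for $n\ge1$, and $[\mathbf{C}^{\mathrm{IV}}_4]_{n,k}=\sqrt{1/2}\cos\frac{\pi(2n+1)(2k+1)}{16}$, $n,k=0,\dots,3$. $e_0=(1,0,0,0)^T$. The characteristic polynomial of a matrix $A$ is $\det(\mu\mathbf{I}-A)$. A Givens rotation by $\theta$ in the plane $(p,q)$, $p<q$, is the $4\times4$ identity matrix with the entries at positions $(p,p),(p,q),(q,p),(q,q)$ replaced by $\cos\theta,-\sin\theta,\sin\theta,\cos\theta$. "Expressible in radicals in $\rho$" means obtainable from $\rho$ and rational numbers by finitely many field operations and extractions of $n$-th roots (intermediate values may be complex). The matrices $\mathbf{Q}^{(s)}_4,\mathbf{Q}^{(a)}_4$ are the correction factors in the exact factorization $\mathbf{W}_8(\rho)=\mathbf{P}_8(\mathbf{Q}^{(s)}_4\mathbf{C}^{\mathrm{II}}_4\oplus\mathbf{Q}^{(a)}_4\mathbf{C}^{\mathrm{IV}}_4)\mathbf{B}_8$ of the Karhunen--Loève transform of the AR(1) covariance $[\rho^{|i-j|}]_{i,j=0}^7$ (with $\mathbf{P}_8$ an interleaving permutation and $\mathbf{B}_8$ the sum/difference butterfly); this factorization is not needed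 for the statement. *)

theory Defs
  imports Complex_Main "Jordan_Normal_Form.Char_Poly"
begin

definition dct_beta :: "nat \<Rightarrow> real" where
  "dct_beta n = (if n = 0 then 1 / sqrt 2 else 1)"

definition dct_II :: "real mat" where
  "dct_II = mat 4 4 (\<lambda>(n, k).
     sqrt (1/2) * dct_beta n * cos (pi * real n * (2 * real k + 1) / 8))"

definition dct_IV :: "real mat" where
  "dct_IV = mat 4 4 (\<lambda>(n, k).
     sqrt (1/2) * cos (pi * (2 * real n + 1) * (2 * real k + 1) / 16))"

text \<open>The label \<open>x \<in> {s, a}\<close>. The entries \<open>lam x j\<close> and
  \<open>dvals x \<rho> j\<close> below are meaningful only for \<open>j < 4\<close>.\<close>

datatype half = Sym | Asym

fun dct :: "half \<Rightarrow> real mat" where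
  "dct Sym = dct_II"
| "dct Asym = dct_IV"

fun lam :: "half \<Rightarrow> nat \<Rightarrow> real" where
  "lam Sym j = [0, 2 - sqrt 2, 2, 2 + sqrt 2] ! j"
| "lam Asym j = [2 - sqrt (2 + sqrt 2), 2 - sqrt (2 - sqrt 2),
                 2 + sqrt (2 - sqrt 2), 2 + sqrt (2 + sqrt 2)] ! j"

definition dvals :: "half \<Rightarrow> real \<Rightarrow> nat \<Rightarrow> real" where
  "dvals x \<rho> j = \<rho> * lam x j + (1 - \<rho>)\<^sup>2"

definition qvec :: "half \<Rightarrow> real vec" where
  "qvec x = dct x *\<^sub>v unit_vec 4 0"

definition Gmat :: "half \<Rightarrow> real \<Rightarrow> real mat" where
  "Gmat x \<rho> = mat_diag 4 (dvals x \<rho>)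
     + (\<rho> * (1 - \<rho>)) \<cdot>\<^sub>m mat 4 4 (\<lambda>(i, j). qvec x $ i * qvec x $ j)"

text \<open>The quartic \<open>p(\<mu>; \<rho>)\<close> as a polynomial in \<open>\<mu>\<close>, constant coefficient first.\<close>

definition quartic :: "real \<Rightarrow> real poly" where
  "quartic \<rho> =
    [: 1 - \<rho>,
       - (4 - 3*\<rho> + 3*\<rho>^2 - 2*\<rho>^3 + 2*\<rho>^4 - \<rho>^5 + \<rho>^6),
       6 - 3*\<rho> + 6*\<rho>^2 - 2*\<rho>^3 + 3*\<rho>^4,
       - (4 - \<rho> + 3*\<rho>^2),
       1 :]"

text \<open>\<open>\<mu> 0 < \<dots> < \<mu> 3\<close> are the eigenvalues of \<open>A\<close>.\<close>

definition ordered_eigenvalues :: "real mat \<Rightarrow> (nat \<Rightarrow> real) \<Rightarrow> bool" where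
  "ordered_eigenvalues A \<mu> \<longleftrightarrow>
     strict_mono_on {..<4} \<mu> \<and> {k. eigenvalue A k} = \<mu> ` {..<4}"

text \<open>The matrix \<open>Q\<close> belonging to \<open>x\<close> is determined only up to the sign of each row, so it
  is a predicate; the unit length of the rows is part of orthogonality. The order of
  the eigenvalues is required only weakly here; their simplicity is a matter of proof.\<close>

definition is_Qmat :: "half \<Rightarrow> real \<Rightarrow> real mat \<Rightarrow> bool" where
  "is_Qmat x \<rho> Q \<longleftrightarrow>
     Q \<in> carrier_mat 4 4 \<and> Q * transpose_mat Q = 1\<^sub>m 4 \<and> transpose_mat Q * Q = 1\<^sub>m 4 \<and>
     (\<exists>\<nu> :: nat \<Rightarrow> real. mono_on {..<4} \<nu> \<and>
        (\<forall>i<4. eigenvector (Gmat x \<rho>) (row Q i) (\<nu> i)))"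

definition givens :: "nat \<Rightarrow> nat \<Rightarrow> real \<Rightarrow> real mat" where
  "givens p q \<theta> = mat 4 4 (\<lambda>(i, j).
     if (i, j) = (p, p) \<or> (i, j) = (q, q) then cos \<theta>
     else if (i, j) = (p, q) then - sin \<theta>
     else if (i, j) = (q, p) then sin \<theta>
     else if i = j then 1 else 0)"

definition givens_factorization :: "real mat \<Rightarrow> (nat \<Rightarrow> real) \<Rightarrow> bool" where
  "givens_factorization Q \<theta> \<longleftrightarrow>
     (\<exists>\<sigma> :: nat \<Rightarrow> real. (\<forall>k<4. \<sigma> k = 1 \<or> \<sigma> k = - 1) \<and>
        Q = givens 0 1 (\<theta> 1) * givens 0 2 (\<theta> 2) * givens 0 3 (\<theta> 3) *
            givens 1 2 (\<theta> 4) * givens 1 3 (\<theta> 5) * givens 2 3 (\<theta> 6) * mat_diag 4 \<sigma>)"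

text \<open>The complex numbers expressible in radicals in \<open>\<rho>\<close>. The rule \<open>root\<close> admits every
  complex \<open>n\<close>-th root.\<close>

inductive_set radicals :: "complex \<Rightarrow> complex set" for \<rho> :: complex where
  param: "\<rho> \<in> radicals \<rho>"
| rat: "of_rat r \<in> radicals \<rho>"
| add: "a \<in> radicals \<rho> \<Longrightarrow> b \<in> radicals \<rho> \<Longrightarrow> a + b \<in> radicals \<rho>"
| diff: "a \<in> radicals \<rho> \<Longrightarrow> b \<in> radicals \<rho> \<Longrightarrow> a - b \<in> radicals \<rho>"
| mult: "a \<in> radicals \<rho> \<Longrightarrow> b \<in> radicals \<rho> \<Longrightarrow> a * b \<in> radicals \<rho>"
| divide: "a \<in> radicals \<rho> \<Longrightarrow> b \<in> radicals \<rho> \<Longrightarrow> b \<noteq> 0 \<Longrightarrow> a / b \<in> radicals \<rho>"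
| root: "z ^ n \<in> radicals \<rho> \<Longrightarrow> n > 0 \<Longrightarrow> z \<in> radicals \<rho>"

definition expressible_in_radicals :: "real \<Rightarrow> real \<Rightarrow> bool" where
  "expressible_in_radicals \<rho> y \<longleftrightarrow> complex_of_real y \<in> radicals (complex_of_real \<rho>)"

end

theory Submission
  imports Defs "HOL-Computational_Algebra.Fundamental_Theorem_Algebra"
begin

text \<open>\<open>G = diag(d) + c q q\<^sup>T\<close> has no eigenvalue among the \<open>d\<^sub>j\<close> because no \<open>q\<^sub>j\<close> vanishes, so
  \<open>\<mu>\<close> is an eigenvalue iff \<open>1 + c \<Sum>\<^sub>j q\<^sub>j\<^sup>2 / (d\<^sub>j - \<mu>) = 0\<close>, with eigenvector \<open>q\<^sub>j / (d\<^sub>j - \<mu>)\<close>.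
  Clearing denominators in the secular equation gives a monic quartic with four sign changes; it
  shares its four roots with the characteristic polynomial, so the two agree and no determinant has
  to be expanded. Radical expressions for the eigenvalues come from Ferrari's method, and the Givens
  rotations are those of the QR factorization, whose angles need only square roots.\<close>

section \<open>Closure properties of radical expressions\<close>

text \<open>Undoing the DCT explains the constants: \<open>Gmat\<close> becomes the tridiagonal
  matrix with off-diagonal \<open>- \<rho>\<close> and diagonal \<open>1\<close>,
  \<open>1 + \<rho>^2\<close>, \<open>1 + \<rho>^2\<close>, and last entry
  \<open>1 + \<rho>^2 - \<rho>\<close> (symmetric half) or \<open>1 + \<rho>^2 + \<rho>\<close>
  (antisymmetric half). The numbers \<open>lam\<close> belong to the discrete Laplacian with these
  end conditions, and the rank-one term corrects its corner entry from
  \<open>1 - \<rho> + \<rho>^2\<close> to \<open>1\<close>. Conjugation by alternating signs carries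
  the symmetric matrix at \<open>- \<rho>\<close> to the antisymmetric one at \<open>\<rho>\<close>,
  which is why one quartic serves both. The delicate point is that \<open>is_Qmat\<close> orders the
  eigenvalues only weakly. Simplicity has to come from the fact that all eigenvectors for
  \<open>x\<close> are multiples of one explicit vector, so two orthonormal rows cannot share an
  eigenvalue.\<close>

lemma radicals_0: "0 \<in> radicals \<rho>"
  using radicals.rat[of 0] by simp

lemma radicals_1: "1 \<in> radicals \<rho>"
  using radicals.rat[of 1] by simp

lemma radicals_numeral: "numeral n \<in> radicals \<rho>"
  using radicals.rat[of "numeral n"] by simp

lemma radicals_uminus: "a \<in> radicals \<rho> \<Longrightarrow> - a \<in> radicals \<rho>"
  using radicals.diff[OF radicals_0, of a] by simp

lemma radicals_power: "a \<in> radicals \<rho> \<Longrightarrow> a ^ n \<in> radicals \<rho>"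
  by (induction n) (auto intro: radicals_1 radicals.mult)

text \<open>Division by zero yields 0, which is expressible. Without the side condition, closure
  goals follow the shape of the term alone.\<close>

lemma radicals_divide: "a \<in> radicals \<rho> \<Longrightarrow> b \<in> radicals \<rho> \<Longrightarrow> a / b \<in> radicals \<rho>"
  using radicals.divide[of a \<rho> b] radicals_0[of \<rho>] by (cases "b = 0") simp_all

lemmas radicals_closed = radicals.param radicals.add radicals.diff radicals.mult radicals_0
  radicals_1 radicals_numeral radicals_uminus radicals_power radicals_divide

section \<open>Polynomial equations of degree at most four\<close>

lemma radicals_quadratic:
  assumes bc: "b \<in> radicals \<rho>" "c \<in> radicals \<rho>" and z: "z ^ 2 + b * z + c = 0"
  shows "z \<in> radicals \<rho>"
proof -
  define b' where "b' = b / 2"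
  have b: "b = 2 * b'" and b': "b' \<in> radicals \<rho>"
    unfolding b'_def by (simp, intro radicals_closed bc)
  have "(z + b') ^ 2 = b' ^ 2 - c"
    using z unfolding b by Groebner_Basis.algebra
  moreover have "b' ^ 2 - c \<in> radicals \<rho>"
    by (intro radicals_closed bc b')
  ultimately have "z + b' \<in> radicals \<rho>"
    by (intro radicals.root[of "z + b'" 2]) simp_all
  then have "(z + b') - b' \<in> radicals \<rho>"
    by (intro radicals.diff b')
  then show ?thesis by simp
qed

text \<open>Cardano: write \<open>t = u + v\<close> with \<open>3 u v = - p\<close>; then \<open>u\<^sup>3\<close> is a root of
  \<open>y\<^sup>2 + q y - (p / 3)\<^sup>3\<close>.\<close>

lemma radicals_depressed_cubic:
  assumes p: "p \<in> radicals \<rho>" and q: "q \<in> radicals \<rho>" and t: "t ^ 3 + p * t + q = 0"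
  shows "t \<in> radicals \<rho>"
proof (cases "p = 0")
  case True
  with t have "t ^ 3 = - q" by (simp add: eq_neg_iff_add_eq_0)
  then show ?thesis
    using radicals.root[of t 3] radicals_uminus[OF q] by simp
next
  case False
  define p' where "p' = p / 3"
  have p_eq: "p = 3 * p'" and p': "p' \<in> radicals \<rho>"
    unfolding p'_def by (simp, intro radicals_closed p)
  \<comment> \<open>\<open>u\<close> and \<open>v\<close> will be the roots of
    \<open>X^2 - t X - p'\<close>, whose discriminant is \<open>s^2\<close>. As \<open>s\<close> is
    built from \<open>t\<close>, it gives no membership by itself; that comes from the quadratic for
    \<open>u^3\<close>.\<close>
  define s where "s = csqrt (t\<^sup>2 + 4 * p')"
  have s: "s\<^sup>2 = t\<^sup>2 + 4 * p'" by (simp add: s_def)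
  define u where "u = (t + s) / 2"
  have s_eq: "s = 2 * u - t" by (simp add: u_def add_divide_distrib)
  define v where "v = t - u"
  have t_eq: "t = u + v" by (simp add: v_def)
  have "4 * p' = 4 * (- (u * v))"
    using s unfolding s_eq t_eq by Groebner_Basis.algebra
  then have uv: "p' = - (u * v)" by simp
  with False p_eq have u0: "u \<noteq> 0" by auto
  have "(u ^ 3) ^ 2 + q * u ^ 3 + - (p' ^ 3) = 0"
    using t unfolding t_eq p_eq uv by Groebner_Basis.algebra
  from radicals_quadratic[OF q _ this] have "u ^ 3 \<in> radicals \<rho>"
    by (auto intro: radicals_closed p')
  then have u: "u \<in> radicals \<rho>" by (rule radicals.root) simp
  have "t = u - p' / u"
    using uv u0 by (simp add: t_eq)
  moreover have "u - p' / u \<in> radicals \<rho>"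
    by (intro radicals_closed u p')
  ultimately show ?thesis by simp
qed

lemma radicals_cubic:
  assumes abc: "a \<in> radicals \<rho>" "b \<in> radicals \<rho>" "c \<in> radicals \<rho>"
    and t: "t ^ 3 + a * t ^ 2 + b * t + c = 0"
  shows "t \<in> radicals \<rho>"
proof -
  define a' where "a' = a / 3"
  have a_eq: "a = 3 * a'" and a': "a' \<in> radicals \<rho>"
    unfolding a'_def by (simp, intro radicals_closed abc)
  have y: "(t + a') ^ 3 + (b - 3 * a' ^ 2) * (t + a') + (2 * a' ^ 3 - a' * b + c) = 0"
    using t unfolding a_eq by Groebner_Basis.algebra
  have "t + a' \<in> radicals \<rho>"
    by (rule radicals_depressed_cubic[OF _ _ y]) (intro radicals_closed abc a')+
  then have "(t + a') - a' \<in> radicals \<rho>"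
    by (intro radicals.diff a')
  then show ?thesis by simp
qed

text \<open>Ferrari: for a root \<open>m\<close> of the resolvent cubic and \<open>s\<^sup>2 = 2 m\<close>, the quartic is the
  difference of two squares \<open>(w\<^sup>2 + p / 2 + m)\<^sup>2 - s\<^sup>2 (w - q / (4 m))\<^sup>2\<close>.\<close>

lemma radicals_depressed_quartic:
  assumes pqr: "p \<in> radicals \<rho>" "q \<in> radicals \<rho>" "r \<in> radicals \<rho>"
    and w: "w ^ 4 + p * w ^ 2 + q * w + r = 0"
  shows "w \<in> radicals \<rho>"
proof (cases "q = 0")
  case True
  then have "(w ^ 2) ^ 2 + p * w ^ 2 + r = 0" using w by simp
  then have "w ^ 2 \<in> radicals \<rho>" by (rule radicals_quadratic[OF pqr(1,3)])
  then show ?thesis by (rule radicals.root) simp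
next
  case False
  define p' where "p' = p / 2"
  have p_eq: "p = 2 * p'" and p': "p' \<in> radicals \<rho>"
    unfolding p'_def by (simp, intro radicals_closed pqr)
  define q' where "q' = q / 8"
  have q_eq: "q = 8 * q'" and q': "q' \<in> radicals \<rho>"
    unfolding q'_def by (simp, intro radicals_closed pqr)
  \<comment> \<open>\<open>(w^2 + p' + m)^2\<close> minus the quartic is the quadratic
    \<open>2 m w^2 - q w + (p' + m)^2 - r\<close> in \<open>w\<close>. \<open>R\<close> is its
    discriminant divided by \<open>- 8\<close>, as a polynomial in \<open>m\<close>; any root will
    do, and \<open>q \<noteq> 0\<close> keeps it away from 0.\<close>
  define R where "R = [: - 8 * q' ^ 2, p' ^ 2 - r, 2 * p', 1 :]"
  have "\<not> constant (poly R)" by (simp add: constant_degree R_def)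
  then obtain m where "poly R m = 0"
    using fundamental_theorem_of_algebra by blast
  then have m: "m ^ 3 + 2 * p' * m ^ 2 + (p' ^ 2 - r) * m + (- 8 * q' ^ 2) = 0"
    unfolding R_def by (simp only: poly_pCons poly_0) Groebner_Basis.algebra
  have mR: "m \<in> radicals \<rho>"
    by (rule radicals_cubic[OF _ _ _ m]) (intro radicals_closed pqr p' q')+
  have m0: "m \<noteq> 0" using m False q_eq by auto
  define s where "s = csqrt (2 * m)"
  have s2: "s ^ 2 = 2 * m" by (simp add: s_def)
  have "s ^ 2 \<in> radicals \<rho>"
    unfolding s2 by (intro radicals_closed mR)
  then have sR: "s \<in> radicals \<rho>" by (rule radicals.root) simp
  \<comment> \<open>This is \<open>q / (4 * m)\<close>, the double root of that quadratic.\<close>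
  define k where "k = 2 * q' / m"
  have kR: "k \<in> radicals \<rho>" unfolding k_def by (intro radicals_closed q' mR)
  have "k * m = 2 * q'" using m0 by (simp add: k_def)
  then have kq: "q = 4 * m * k" using q_eq by Groebner_Basis.algebra
  have "m * (m ^ 2 + 2 * p' * m + p' ^ 2 - r - 2 * m * k ^ 2) = 0"
    using m \<open>k * m = 2 * q'\<close> by Groebner_Basis.algebra
  then have r: "m ^ 2 + 2 * p' * m + p' ^ 2 - r - 2 * m * k ^ 2 = 0"
    using m0 by simp
  have "(w ^ 2 + p' + m) ^ 2 = (s * (w - k)) ^ 2"
    using w r s2 unfolding p_eq kq by Groebner_Basis.algebra
  then have "w ^ 2 + p' + m = s * (w - k) \<or> w ^ 2 + p' + m = - (s * (w - k))"
    by (simp only: power2_eq_iff)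
  then show ?thesis
  proof
    assume "w ^ 2 + p' + m = s * (w - k)"
    then have e: "w ^ 2 + (- s) * w + (p' + m + s * k) = 0" by Groebner_Basis.algebra
    show ?thesis
      by (rule radicals_quadratic[OF _ _ e]) (intro radicals_closed p' sR mR kR)+
  next
    assume "w ^ 2 + p' + m = - (s * (w - k))"
    then have e: "w ^ 2 + s * w + (p' + m - s * k) = 0" by Groebner_Basis.algebra
    show ?thesis
      by (rule radicals_quadratic[OF _ _ e]) (intro radicals_closed p' sR mR kR)+
  qed
qed

lemma radicals_quartic:
  assumes abcd: "a \<in> radicals \<rho>" "b \<in> radicals \<rho>" "c \<in> radicals \<rho>" "d \<in> radicals \<rho>"
    and z: "z ^ 4 + a * z ^ 3 + b * z ^ 2 + c * z + d = 0"
  shows "z \<in> radicals \<rho>"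
proof -
  define a' where "a' = a / 4"
  have a_eq: "a = 4 * a'" and a': "a' \<in> radicals \<rho>"
    unfolding a'_def by (simp, intro radicals_closed abcd)
  have y: "(z + a') ^ 4 + (b - 6 * a' ^ 2) * (z + a') ^ 2 + (c - 2 * a' * b + 8 * a' ^ 3) * (z + a')
      + (d - a' * c + a' ^ 2 * b - 3 * a' ^ 4) = 0"
    using z unfolding a_eq by Groebner_Basis.algebra
  have "z + a' \<in> radicals \<rho>"
    by (rule radicals_depressed_quartic[OF _ _ _ y]) (intro radicals_closed abcd a')+
  then have "(z + a') - a' \<in> radicals \<rho>"
    by (intro radicals.diff a')
  then show ?thesis by simp
qed

section \<open>Real numbers expressible in radicals\<close>

context
  fixes \<rho> :: real
begin

lemma expressible_arith:
  "expressible_in_radicals \<rho> \<rho>"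
  "expressible_in_radicals \<rho> 0"
  "expressible_in_radicals \<rho> 1"
  "expressible_in_radicals \<rho> (numeral n)"
  "expressible_in_radicals \<rho> a \<Longrightarrow> expressible_in_radicals \<rho> (- a)"
  "expressible_in_radicals \<rho> a \<Longrightarrow> expressible_in_radicals \<rho> (a ^ k)"
  "expressible_in_radicals \<rho> a \<Longrightarrow> expressible_in_radicals \<rho> b \<Longrightarrow> expressible_in_radicals \<rho> (a + b)"
  "expressible_in_radicals \<rho> a \<Longrightarrow> expressible_in_radicals \<rho> b \<Longrightarrow> expressible_in_radicals \<rho> (a - b)"
  "expressible_in_radicals \<rho> a \<Longrightarrow> expressible_in_radicals \<rho> b \<Longrightarrow> expressible_in_radicals \<rho> (a * b)"
  "expressible_in_radicals \<rho> a \<Longrightarrow> expressible_in_radicals \<rho> b \<Longrightarrow> expressible_in_radicals \<rho> (a / b)"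
  unfolding expressible_in_radicals_def by (simp_all add: radicals_closed)

lemma expressible_if_power2:
  assumes "expressible_in_radicals \<rho> (a\<^sup>2)"
  shows "expressible_in_radicals \<rho> a"
  using assms radicals.root[of "complex_of_real a" 2]
  by (simp add: expressible_in_radicals_def)

text \<open>The real \<open>sqrt\<close> is an odd function, so its square is the absolute value for
  either sign of \<open>a\<close>, and nested roots cause no nonnegativity conditions.\<close>

lemma expressible_sqrt:
  assumes "expressible_in_radicals \<rho> a"
  shows "expressible_in_radicals \<rho> (sqrt a)"
proof (rule expressible_if_power2)
  have "(sqrt a)\<^sup>2 = \<bar>a\<bar>"
  proof (cases "a \<ge> 0")
    case False
    have "(sqrt a)\<^sup>2 = (sqrt (- a))\<^sup>2" by (simp only: real_sqrt_minus power2_minus)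
    with False show ?thesis by simp
  qed simp
  then show "expressible_in_radicals \<rho> ((sqrt a)\<^sup>2)"
    using assms expressible_arith(5)[OF assms] by (simp add: abs_if)
qed

lemma expressible_sum:
  assumes "\<And>k. k \<in> I \<Longrightarrow> expressible_in_radicals \<rho> (f k)"
  shows "expressible_in_radicals \<rho> (sum f I)"
  using assms by (induction I rule: infinite_finite_induct) (simp_all add: expressible_arith)

lemmas expressible_intros = expressible_arith expressible_sqrt expressible_sum

text \<open>\<open>r\<close> is kept apart from \<open>\<rho>\<close> because the antisymmetric half
  uses the quartic at \<open>- \<rho>\<close>, while radicals are still taken over
  \<open>\<rho>\<close>.\<close>

lemma expressible_quartic_root:
  assumes "poly (quartic r) x = 0" and r: "expressible_in_radicals \<rho> r"
  shows "expressible_in_radicals \<rho> x"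
proof -
  let ?a = "- (4 - r + 3*r^2)"
  let ?b = "6 - 3*r + 6*r^2 - 2*r^3 + 3*r^4"
  let ?c = "- (4 - 3*r + 3*r^2 - 2*r^3 + 2*r^4 - r^5 + r^6)"
  let ?d = "1 - r"
  have "x ^ 4 + ?a * x ^ 3 + ?b * x ^ 2 + ?c * x + ?d = 0"
    using assms(1) unfolding quartic_def by (simp only: poly_pCons poly_0) Groebner_Basis.algebra
  then have "complex_of_real (x ^ 4 + ?a * x ^ 3 + ?b * x ^ 2 + ?c * x + ?d) = 0"
    by simp
  then have "complex_of_real x ^ 4 + complex_of_real ?a * complex_of_real x ^ 3
     + complex_of_real ?b * complex_of_real x ^ 2 + complex_of_real ?c * complex_of_real x
     + complex_of_real ?d = 0"
    by (simp only: of_real_add of_real_mult of_real_power)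
  moreover have "expressible_in_radicals \<rho> ?a" "expressible_in_radicals \<rho> ?b"
    "expressible_in_radicals \<rho> ?c" "expressible_in_radicals \<rho> ?d"
    by (intro expressible_intros r)+
  ultimately show ?thesis
    unfolding expressible_in_radicals_def by (blast intro: radicals_quartic)
qed

end

section \<open>Givens rotations\<close>

lemma givens_carrier [simp]: "givens p q \<theta> \<in> carrier_mat 4 4"
  by (simp add: givens_def)

lemma index_givens_mult:
  assumes B: "B \<in> carrier_mat 4 m" and "p < q" "q < 4" "i < 4" "j < m"
  shows "(givens p q \<theta> * B) $$ (i, j) =
    (if i = p then cos \<theta> * B $$ (p, j) - sin \<theta> * B $$ (q, j)
     else if i = q then sin \<theta> * B $$ (p, j) + cos \<theta> * B $$ (q, j)
     else B $$ (i, j))"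
proof -
  have "(givens p q \<theta> * B) $$ (i, j) = (\<Sum>k\<in>{0..<4}. givens p q \<theta> $$ (i, k) * B $$ (k, j))"
    using assms by (simp add: givens_def scalar_prod_def)
  \<comment> \<open>Each of the three summands is supported at a single \<open>k\<close>, so the
    sums collapse; the third one is zero when \<open>i\<close> is \<open>p\<close> or
    \<open>q\<close>.\<close>
  also have "\<dots> = (\<Sum>k\<in>{0..<4}.
      (if k = p then (if i = p then cos \<theta> else if i = q then sin \<theta> else 0) * B $$ (p, j) else 0)
    + (if k = q then (if i = p then - sin \<theta> else if i = q then cos \<theta> else 0) * B $$ (q, j) else 0)
    + (if k = i then (if i = p \<or> i = q then 0 else B $$ (i, j)) else 0))"
    using assms by (intro sum.cong) (auto simp: givens_def)
  also have "\<dots> = (if i = p then cos \<theta> * B $$ (p, j) - sin \<theta> * B $$ (q, j)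
     else if i = q then sin \<theta> * B $$ (p, j) + cos \<theta> * B $$ (q, j)
     else B $$ (i, j))"
    using assms by (auto simp: sum.distrib)
  finally show ?thesis .
qed

lemma givens_mult_givens_uminus:
  assumes "p < q" "q < 4"
  shows "givens p q \<theta> * givens p q (- \<theta>) = 1\<^sub>m 4"
proof (rule eq_matI)
  fix i j assume "i < dim_row (1\<^sub>m 4 :: real mat)" "j < dim_col (1\<^sub>m 4 :: real mat)"
  then have ij: "i < 4" "j < 4" by simp_all
  have [simp]: "cos \<theta> * cos \<theta> + sin \<theta> * sin \<theta> = 1" "sin \<theta> * sin \<theta> + cos \<theta> * cos \<theta> = 1"
    using sin_cos_squared_add[of \<theta>] by (simp_all add: power2_eq_square)
  show "(givens p q \<theta> * givens p q (- \<theta>)) $$ (i, j) = 1\<^sub>m 4 $$ (i, j)"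
    unfolding index_givens_mult[OF givens_carrier assms ij]
    using ij assms by (auto simp: givens_def)
qed (simp_all add: givens_def)

lemma transpose_givens:
  assumes "p < q"
  shows "transpose_mat (givens p q \<theta>) = givens p q (- \<theta>)"
proof (rule eq_matI)
  fix i j assume "i < dim_row (givens p q (- \<theta>))" "j < dim_col (givens p q (- \<theta>))"
  then have ij: "i < 4" "j < 4" by (simp_all add: givens_def)
  show "transpose_mat (givens p q \<theta>) $$ (i, j) = givens p q (- \<theta>) $$ (i, j)"
    using ij assms
    by (cases "i = p"; cases "i = q"; cases "j = p"; cases "j = q") (simp_all add: givens_def)
qed (simp_all add: givens_def)

text \<open>One step of the QR factorization. The last two conclusions protect zeros made earlier:
  rows outside the plane are untouched, and a column vanishing in both rows \<open>p\<close> and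
  \<open>q\<close> keeps vanishing there.\<close>

lemma givens_elimination:
  fixes A :: "real mat"
  assumes A: "A \<in> carrier_mat 4 4" and orth: "transpose_mat A * A = 1\<^sub>m 4"
    and E: "\<forall>i<4. \<forall>j<4. expressible_in_radicals \<rho> (A $$ (i, j))"
    and pq: "p < q" "q < 4" and c: "c < 4"
  obtains \<theta> B where "expressible_in_radicals \<rho> (cos \<theta>)" "expressible_in_radicals \<rho> (sin \<theta>)"
    and "A = givens p q \<theta> * B" "B \<in> carrier_mat 4 4" "transpose_mat B * B = 1\<^sub>m 4"
    and "\<forall>i<4. \<forall>j<4. expressible_in_radicals \<rho> (B $$ (i, j))"
    and "B $$ (q, c) = 0"
    and "\<And>i j. i < 4 \<Longrightarrow> j < 4 \<Longrightarrow> i \<noteq> p \<Longrightarrow> i \<noteq> q \<Longrightarrow> B $$ (i, j) = A $$ (i, j)"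
    and "\<And>i j. i < 4 \<Longrightarrow> j < 4 \<Longrightarrow> A $$ (p, j) = 0 \<Longrightarrow> A $$ (q, j) = 0 \<Longrightarrow> i = p \<or> i = q \<Longrightarrow> B $$ (i, j) = 0"
proof -
  let ?a = "A $$ (p, c)" and ?b = "A $$ (q, c)"
  define n where "n = sqrt (?a\<^sup>2 + ?b\<^sup>2)"
  have p4: "p < 4" using pq by simp
  have Eab: "expressible_in_radicals \<rho> ?a" "expressible_in_radicals \<rho> ?b"
    using E c pq p4 by blast+
  then have En: "expressible_in_radicals \<rho> n"
    unfolding n_def by (intro expressible_intros)
  have "\<exists>\<theta>. expressible_in_radicals \<rho> (cos \<theta>) \<and> expressible_in_radicals \<rho> (sin \<theta>)
    \<and> cos \<theta> * ?b = sin \<theta> * ?a"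
  \<comment> \<open>The rotation sends the pair \<open>?a\<close>, \<open>?b\<close> to
    \<open>n\<close>, 0. If both entries are already zero there is no direction to normalize, and
    the angle 0 serves.\<close>
  proof (cases "n = 0")
    case True
    then have "?a = 0" "?b = 0" by (simp_all add: n_def)
    then show ?thesis by (intro exI[of _ 0]) (simp add: expressible_intros)
  next
    case False
    have n2: "n\<^sup>2 = ?a\<^sup>2 + ?b\<^sup>2" by (simp add: n_def)
    have "(?a / n)\<^sup>2 + (?b / n)\<^sup>2 = n\<^sup>2 / n\<^sup>2"
      by (simp only: power_divide n2 add_divide_distrib)
    also have "\<dots> = 1" using False by simp
    finally have "(?a / n)\<^sup>2 + (?b / n)\<^sup>2 = 1" .
    then obtain \<theta> where "?a / n = cos \<theta>" "?b / n = sin \<theta>"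
      using sincos_total_2pi by metis
    then show ?thesis
      using Eab En by (intro exI[of _ \<theta>]) (auto intro!: expressible_intros simp flip: \<open>?a / n = cos \<theta>\<close> \<open>?b / n = sin \<theta>\<close>)
  qed
  then obtain \<theta> where Ecs: "expressible_in_radicals \<rho> (cos \<theta>)" "expressible_in_radicals \<rho> (sin \<theta>)"
    and zero: "cos \<theta> * ?b = sin \<theta> * ?a" by blast
  define B where "B = givens p q (- \<theta>) * A"
  have B: "B \<in> carrier_mat 4 4" using A by (simp add: B_def mult_carrier_mat[of _ 4 4])
  have idx: "B $$ (i, j) =
    (if i = p then cos \<theta> * A $$ (p, j) + sin \<theta> * A $$ (q, j)
     else if i = q then cos \<theta> * A $$ (q, j) - sin \<theta> * A $$ (p, j)
     else A $$ (i, j))" if "i < 4" "j < 4" for i j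
    unfolding B_def index_givens_mult[OF A pq that] by auto
  have "givens p q \<theta> * B = (givens p q \<theta> * givens p q (- \<theta>)) * A"
    unfolding B_def using A by (intro assoc_mult_mat[symmetric, of _ 4 4 _ 4 _ 4]) simp_all
  then have AB: "A = givens p q \<theta> * B"
    using A by (simp add: givens_mult_givens_uminus[OF pq])
  have "transpose_mat B * B = transpose_mat A * (givens p q \<theta> * B)"
    using A B transpose_givens[OF pq(1), of "- \<theta>"]
    by (subst B_def) (simp add: transpose_mult[of _ 4 4 _ 4] assoc_mult_mat[of _ 4 4 _ 4 _ 4])
  then have "transpose_mat B * B = 1\<^sub>m 4"
    unfolding AB[symmetric] orth .
  moreover have "\<forall>i<4. \<forall>j<4. expressible_in_radicals \<rho> (B $$ (i, j))"
    using E pq p4 by (auto simp: idx intro!: expressible_intros Ecs)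
  moreover have "B $$ (q, c) = 0"
    using pq c zero by (simp add: idx)
  moreover have "B $$ (i, j) = A $$ (i, j)" if "i < 4" "j < 4" "i \<noteq> p" "i \<noteq> q" for i j
    using that by (simp add: idx)
  moreover have "B $$ (i, j) = 0"
    if "i < 4" "j < 4" "A $$ (p, j) = 0" "A $$ (q, j) = 0" "i = p \<or> i = q" for i j
    using that by (auto simp: idx)
  ultimately show thesis
    using that Ecs AB B by blast
qed

lemma all_less_4: "(\<forall>i<4. P i) \<longleftrightarrow> P 0 \<and> P 1 \<and> P 2 \<and> P (3::nat)"
  by (auto simp: numeral_eq_Suc less_Suc_eq)

lemma sum_4: "(\<Sum>k\<in>{0..<4}. f k) = f 0 + f 1 + f 2 + f (3::nat)"
  by (simp add: numeral_eq_Suc)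

text \<open>Unit length makes column 0 a signed basis vector; orthogonality to it clears the rest of
  row 0, and the argument repeats for the next column.\<close>

lemma upper_triangular_orthogonal:
  fixes B :: "real mat"
  assumes B: "B \<in> carrier_mat 4 4" and orth: "transpose_mat B * B = 1\<^sub>m 4"
    and tri: "upper_triangular B"
  shows "\<exists>\<sigma>. (\<forall>k<4. \<sigma> k = 1 \<or> \<sigma> k = - 1) \<and> B = mat_diag 4 \<sigma>"
proof -
  have col: "B $$ (0, i) * B $$ (0, j) + B $$ (1, i) * B $$ (1, j)
      + B $$ (2, i) * B $$ (2, j) + B $$ (3, i) * B $$ (3, j) = (if i = j then 1 else 0)"
    if "i < 4" "j < 4" for i j
  proof -
    have "(transpose_mat B * B) $$ (i, j) = (\<Sum>k\<in>{0..<4}. B $$ (k, i) * B $$ (k, j))"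
      using B that by (simp add: scalar_prod_def)
    then show ?thesis using that by (simp add: orth sum_4)
  qed
  have low: "B $$ (i, j) = 0" if "j < i" "i < 4" for i j
    using tri that B by (auto simp: upper_triangular_def)
  have d0: "(B $$ (0, 0))\<^sup>2 = 1"
    using col[of 0 0] low[of 0 1] low[of 0 2] low[of 0 3] by (simp add: power2_eq_square)
  then have 0: "B $$ (0, j) = 0" if "0 < j" "j < 4" for j
    using col[of 0 j] low[of 0 1] low[of 0 2] low[of 0 3] that by auto
  have d1: "(B $$ (1, 1))\<^sup>2 = 1"
    using col[of 1 1] 0[of 1] low[of 1 2] low[of 1 3] by (simp add: power2_eq_square)
  then have 1: "B $$ (1, j) = 0" if "1 < j" "j < 4" for j
    using col[of 1 j] 0[of 1] low[of 1 2] low[of 1 3] that by auto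
  have d2: "(B $$ (2, 2))\<^sup>2 = 1"
    using col[of 2 2] 0[of 2] 1[of 2] low[of 2 3] by (simp add: power2_eq_square)
  then have 2: "B $$ (2, 3) = 0"
    using col[of 2 3] 0[of 2] 1[of 2] low[of 2 3] by auto
  have d3: "(B $$ (3, 3))\<^sup>2 = 1"
    using col[of 3 3] 0[of 3] 1[of 3] 2 by (simp add: power2_eq_square)
  have off: "B $$ (i, j) = 0" if ij: "i < 4" "j < 4" "i \<noteq> j" for i j
  proof (cases "j < i")
    case False
    then have "i < j" using ij by simp
    then consider "i = 0" | "i = 1" | "i = 2" "j = 3" using ij by linarith
    then show ?thesis using 0 1 2 ij \<open>i < j\<close> by cases simp_all
  qed (use low ij in blast)
  have "\<forall>k<4. (B $$ (k, k))\<^sup>2 = 1"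
    unfolding all_less_4 using d0 d1 d2 d3 by simp
  moreover have "B = mat_diag 4 (\<lambda>k. B $$ (k, k))"
    using B off by (intro eq_matI) (auto simp: mat_diag_def)
  ultimately show ?thesis
    by (intro exI[of _ "\<lambda>k. B $$ (k, k)"]) (auto simp: power2_eq_1_iff)
qed

text \<open>The prescribed planes clear column 0 below the diagonal with pivot row 0, then column 1
  with pivot row 1, then column 2. Each rotation is split off on the left of what remains, so the
  product comes out in the prescribed order and ends in an orthogonal triangular factor.\<close>

lemma expressible_givens_factorization:
  fixes Q :: "real mat"
  assumes "Q \<in> carrier_mat 4 4" "transpose_mat Q * Q = 1\<^sub>m 4"
    and "\<forall>i<4. \<forall>j<4. expressible_in_radicals \<rho> (Q $$ (i, j))"
  shows "\<exists>\<theta>. givens_factorization Q \<theta> \<and>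
    (\<forall>k\<in>{1..6}. expressible_in_radicals \<rho> (cos (\<theta> k)) \<and> expressible_in_radicals \<rho> (sin (\<theta> k)))"
proof -
  obtain \<theta>1 B1 where 1: "expressible_in_radicals \<rho> (cos \<theta>1)" "expressible_in_radicals \<rho> (sin \<theta>1)"
    "Q = givens 0 1 \<theta>1 * B1" "B1 \<in> carrier_mat 4 4" "transpose_mat B1 * B1 = 1\<^sub>m 4"
    "\<forall>i<4. \<forall>j<4. expressible_in_radicals \<rho> (B1 $$ (i, j))"
    and z1: "B1 $$ (1, 0) = 0"
    by (rule givens_elimination[OF assms, of 0 1 0]) simp_all
  obtain \<theta>2 B2 where 2: "expressible_in_radicals \<rho> (cos \<theta>2)" "expressible_in_radicals \<rho> (sin \<theta>2)"
    "B1 = givens 0 2 \<theta>2 * B2" "B2 \<in> carrier_mat 4 4" "transpose_mat B2 * B2 = 1\<^sub>m 4"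
    "\<forall>i<4. \<forall>j<4. expressible_in_radicals \<rho> (B2 $$ (i, j))"
    and z2: "B2 $$ (2, 0) = 0" "B2 $$ (1, 0) = 0"
    by (rule givens_elimination[OF 1(4-6), of 0 2 0]) (use z1 in simp_all)
  obtain \<theta>3 B3 where 3: "expressible_in_radicals \<rho> (cos \<theta>3)" "expressible_in_radicals \<rho> (sin \<theta>3)"
    "B2 = givens 0 3 \<theta>3 * B3" "B3 \<in> carrier_mat 4 4" "transpose_mat B3 * B3 = 1\<^sub>m 4"
    "\<forall>i<4. \<forall>j<4. expressible_in_radicals \<rho> (B3 $$ (i, j))"
    and z3: "B3 $$ (3, 0) = 0" "B3 $$ (2, 0) = 0" "B3 $$ (1, 0) = 0"
    by (rule givens_elimination[OF 2(4-6), of 0 3 0]) (use z2 in simp_all)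
  obtain \<theta>4 B4 where 4: "expressible_in_radicals \<rho> (cos \<theta>4)" "expressible_in_radicals \<rho> (sin \<theta>4)"
    "B3 = givens 1 2 \<theta>4 * B4" "B4 \<in> carrier_mat 4 4" "transpose_mat B4 * B4 = 1\<^sub>m 4"
    "\<forall>i<4. \<forall>j<4. expressible_in_radicals \<rho> (B4 $$ (i, j))"
    and z4: "B4 $$ (2, 1) = 0" "B4 $$ (3, 0) = 0" "B4 $$ (2, 0) = 0" "B4 $$ (1, 0) = 0"
    by (rule givens_elimination[OF 3(4-6), of 1 2 1]) (use z3 in simp_all)
  obtain \<theta>5 B5 where 5: "expressible_in_radicals \<rho> (cos \<theta>5)" "expressible_in_radicals \<rho> (sin \<theta>5)"
    "B4 = givens 1 3 \<theta>5 * B5" "B5 \<in> carrier_mat 4 4" "transpose_mat B5 * B5 = 1\<^sub>m 4"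
    "\<forall>i<4. \<forall>j<4. expressible_in_radicals \<rho> (B5 $$ (i, j))"
    and z5: "B5 $$ (3, 1) = 0" "B5 $$ (2, 1) = 0" "B5 $$ (3, 0) = 0" "B5 $$ (2, 0) = 0" "B5 $$ (1, 0) = 0"
    by (rule givens_elimination[OF 4(4-6), of 1 3 1]) (use z4 in simp_all)
  obtain \<theta>6 B6 where 6: "expressible_in_radicals \<rho> (cos \<theta>6)" "expressible_in_radicals \<rho> (sin \<theta>6)"
    "B5 = givens 2 3 \<theta>6 * B6" "B6 \<in> carrier_mat 4 4" "transpose_mat B6 * B6 = 1\<^sub>m 4"
    and z6: "B6 $$ (3, 2) = 0" "B6 $$ (3, 1) = 0" "B6 $$ (2, 1) = 0" "B6 $$ (3, 0) = 0" "B6 $$ (2, 0) = 0" "B6 $$ (1, 0) = 0"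
    by (rule givens_elimination[OF 5(4-6), of 2 3 2]) (use z5 in simp_all)
  have "upper_triangular B6"
  proof (rule upper_triangularI)
    fix i j assume "j < i" "i < dim_row B6"
    then have "i = 3 \<and> j = 2 \<or> i = 3 \<and> j = 1 \<or> i = 2 \<and> j = 1 \<or> i = 3 \<and> j = 0 \<or> i = 2 \<and> j = 0 \<or> i = 1 \<and> j = 0"
      using 6(4) by auto
    then show "B6 $$ (i, j) = 0" using z6 by auto
  qed
  then obtain \<sigma> where \<sigma>: "\<forall>k<4. \<sigma> k = 1 \<or> \<sigma> k = - 1" "B6 = mat_diag 4 \<sigma>"
    using upper_triangular_orthogonal[OF 6(4,5)] by blast
  \<comment> \<open>The leading 0 only fills index 0, since the angles are numbered from 1.\<close>
  define \<theta> where "\<theta> = (\<lambda>k::nat. [0, \<theta>1, \<theta>2, \<theta>3, \<theta>4, \<theta>5, \<theta>6] ! k)"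
  have \<theta>: "\<theta> 1 = \<theta>1" "\<theta> 2 = \<theta>2" "\<theta> 3 = \<theta>3" "\<theta> 4 = \<theta>4" "\<theta> 5 = \<theta>5" "\<theta> 6 = \<theta>6"
    by (simp_all add: \<theta>_def)
  have "Q = givens 0 1 \<theta>1 * givens 0 2 \<theta>2 * givens 0 3 \<theta>3 *
            givens 1 2 \<theta>4 * givens 1 3 \<theta>5 * givens 2 3 \<theta>6 * mat_diag 4 \<sigma>"
    unfolding 1(3) 2(3) 3(3) 4(3) 5(3) 6(3) \<sigma>(2)
    by (simp add: assoc_mult_mat[of _ 4 4 _ 4 _ 4] mult_carrier_mat[of _ 4 4])
  then have "givens_factorization Q \<theta>"
    unfolding givens_factorization_def \<theta> using \<sigma>(1) by blast
  moreover have "k \<in> {1, 2, 3, 4, 5, 6}" if "k \<in> {1..6}" for k :: nat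
    using that by auto
  ultimately show ?thesis
    using 1(1,2) 2(1,2) 3(1,2) 4(1,2) 5(1,2) 6(1,2) \<theta>
    by (intro exI[of _ \<theta>]) force
qed

section \<open>Rank-one updates of diagonal matrices\<close>

text \<open>Both sequences are the sorted list of their common image. This later identifies the
  eigenvalues attached to the rows of \<open>Q\<close> with the ordered spectrum.\<close>

lemma strict_mono_on_image_unique:
  fixes f g :: "nat \<Rightarrow> 'a::linorder"
  assumes "strict_mono_on {..<n} f" "strict_mono_on {..<n} g" "f ` {..<n} = g ` {..<n}" "i < n"
  shows "f i = g i"
proof -
  have "sorted (map h [0..<n]) \<and> distinct (map h [0..<n])" if "strict_mono_on {..<n} h" for h :: "nat \<Rightarrow> 'a"
    using that by (auto simp: sorted_iff_nth_mono distinct_map atLeast0LessThan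
        intro!: strict_mono_on_leD[of _ h] strict_mono_on_imp_inj_on)
  moreover have "set (map f [0..<n]) = set (map g [0..<n])"
    using assms(3) by (simp add: atLeast0LessThan)
  ultimately have "map f [0..<n] = map g [0..<n]"
    using assms(1,2) sorted_distinct_set_unique by blast
  then show ?thesis
    using \<open>i < n\<close> by simp
qed

lemma strict_mono_on_lessThan_4:
  fixes f :: "nat \<Rightarrow> 'a::order"
  assumes "f 0 < f 1" "f 1 < f 2" "f 2 < f 3"
  shows "strict_mono_on {..<4} f"
proof (rule strict_mono_onI)
  fix i j :: nat assume "i \<in> {..<4}" "j \<in> {..<4}" "i < j"
  then have "i = 0 \<and> j = 1 \<or> i = 0 \<and> j = 2 \<or> i = 0 \<and> j = 3 \<or> i = 1 \<and> j = 2 \<or> i = 1 \<and> j = 3 \<or> i = 2 \<and> j = 3"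
    unfolding lessThan_iff by linarith
  then show "f i < f j"
    using assms by (auto dest: order.strict_trans)
qed

text \<open>Both halves share the whole spectral argument. \<open>\<rho> > 0\<close> will give the
  strict order of \<open>d\<close>, and \<open>0 < \<rho> < 1\<close> the sign of
  \<open>c\<close>.\<close>

locale rank_one_update =
  fixes d q :: "nat \<Rightarrow> real" and c :: real and A :: "real mat"
  assumes d_less: "d 0 < d 1" "d 1 < d 2" "d 2 < d 3"
    and q_nonzero: "\<And>j. j < 4 \<Longrightarrow> q j \<noteq> 0"
    and c_pos: "c > 0"
    and A_eq: "A = mat_diag 4 d + c \<cdot>\<^sub>m mat 4 4 (\<lambda>(i, j). q i * q j)"
begin

definition secular_poly :: "real \<Rightarrow> real" where
  "secular_poly x = (x - d 0) * (x - d 1) * (x - d 2) * (x - d 3)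
    - c * ((q 0)\<^sup>2 * ((x - d 1) * (x - d 2) * (x - d 3)) + (q 1)\<^sup>2 * ((x - d 0) * (x - d 2) * (x - d 3))
         + (q 2)\<^sup>2 * ((x - d 0) * (x - d 1) * (x - d 3)) + (q 3)\<^sup>2 * ((x - d 0) * (x - d 1) * (x - d 2)))"

text \<open>At \<open>x = d j\<close> a summand would silently become 0, so these points are
  excluded explicitly.\<close>

definition is_secular_root :: "real \<Rightarrow> bool" where
  "is_secular_root x \<longleftrightarrow> (\<forall>j<4. d j \<noteq> x) \<and> c * (\<Sum>k\<in>{0..<4}. (q k)\<^sup>2 / (d k - x)) = - 1"

text \<open>The squared length of the vector with entries \<open>q k / (d k - x)\<close>.\<close>

definition gram :: "real \<Rightarrow> real" where
  "gram x = (\<Sum>k<4. (q k)\<^sup>2 / (d k - x)\<^sup>2)"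

lemma A_carrier: "A \<in> carrier_mat 4 4"
  unfolding A_eq by (intro add_carrier_mat) simp

lemma d_strict: "i < j \<Longrightarrow> j < 4 \<Longrightarrow> d i < d j"
  using strict_mono_on_lessThan_4[OF d_less] by (simp add: strict_mono_on_def)

section \<open>Eigenvectors and the secular equation\<close>

lemma index_A_mult_vec:
  assumes "v \<in> carrier_vec 4" "j < 4"
  shows "(A *\<^sub>v v) $ j = d j * v $ j + c * q j * (\<Sum>k\<in>{0..<4}. q k * v $ k)"
proof -
  have "(A *\<^sub>v v) $ j = (\<Sum>k\<in>{0..<4}. A $$ (j, k) * v $ k)"
    using assms A_carrier by (simp add: scalar_prod_def)
  also have "\<dots> = (\<Sum>k\<in>{0..<4}. (if k = j then d j * v $ j else 0) + c * q j * (q k * v $ k))"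
    using assms(2) by (intro sum.cong) (auto simp: A_eq mat_diag_def algebra_simps)
  also have "\<dots> = d j * v $ j + c * q j * (\<Sum>k\<in>{0..<4}. q k * v $ k)"
    using assms(2) by (simp add: sum.distrib sum_distrib_left)
  finally show ?thesis .
qed

text \<open>In coordinates the eigenvalue equation reads
  \<open>(d j - x) * v $ j = - (c * q j * s)\<close>, where \<open>s\<close> is the inner product of
  \<open>q\<close> and \<open>v\<close>. Once \<open>s \<noteq> 0\<close>, no \<open>d j\<close>
  equals \<open>x\<close> and \<open>v\<close> is determined up to a factor; pairing
  \<open>v\<close> with \<open>q\<close> gives the secular equation. Eigenspaces are therefore
  lines.\<close>

lemma eigenvectorE:
  assumes "eigenvector A v x"
  obtains a where "is_secular_root x" "\<And>j. j < 4 \<Longrightarrow> v $ j = a * (q j / (d j - x))"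
proof -
  have dimA: "dim_row A = 4" using A_carrier by simp
  have v: "v \<in> carrier_vec 4" and v0: "v \<noteq> 0\<^sub>v 4" and Av: "A *\<^sub>v v = x \<cdot>\<^sub>v v"
    using assms by (auto simp: eigenvector_def dimA)
  define s where "s = (\<Sum>k\<in>{0..<4}. q k * v $ k)"
  have comp: "(d j - x) * v $ j = - (c * q j * s)" if "j < 4" for j
  proof -
    have "d j * v $ j + c * q j * s = x * v $ j"
      using index_A_mult_vec[OF v that] v that by (simp add: Av s_def)
    then show ?thesis by (simp add: algebra_simps)
  qed
  have nz: "\<exists>j<4. v $ j \<noteq> 0"
    using v v0 by (metis carrier_vecD eq_vecI index_zero_vec)
  \<comment> \<open>If \<open>s = 0\<close>, then \<open>v\<close> lives where
    \<open>d j = x\<close>, hence on one coordinate \<open>i\<close> because the \<open>d j\<close>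
    are distinct; but then \<open>s = q i * v $ i\<close> is nonzero.\<close>
  have "s \<noteq> 0"
  proof
    assume "s = 0"
    obtain i where i: "i < 4" "v $ i \<noteq> 0" using nz by blast
    then have "d i = x" using comp[of i] \<open>s = 0\<close> by simp
    have "v $ k = 0" if "k < 4" "k \<noteq> i" for k
    proof -
      have "d k \<noteq> x" using that i \<open>d i = x\<close> d_strict[of k i] d_strict[of i k] by (cases "k < i") auto
      then show ?thesis using comp[of k] \<open>s = 0\<close> that by simp
    qed
    then have "s = (\<Sum>k\<in>{0..<4}. if k = i then q i * v $ i else 0)"
      unfolding s_def by (intro sum.cong) auto
    then have "s = q i * v $ i" using i by simp
    then show False using \<open>s = 0\<close> i q_nonzero by simp
  qed
  have dx: "d j \<noteq> x" if "j < 4" for j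
    using comp[OF that] \<open>s \<noteq> 0\<close> q_nonzero[OF that] c_pos by auto
  have vj: "v $ j = (- (c * s)) * (q j / (d j - x))" if "j < 4" for j
    using comp[OF that] dx[OF that] by (simp add: field_simps)
  have "s = (\<Sum>k\<in>{0..<4}. - (c * s) * ((q k)\<^sup>2 / (d k - x)))"
    unfolding s_def using vj by (intro sum.cong) (auto simp: power2_eq_square s_def)
  then have "s = - s * (c * (\<Sum>k\<in>{0..<4}. (q k)\<^sup>2 / (d k - x)))"
    by (simp add: sum_distrib_left mult.assoc mult.left_commute)
  then have "s * (c * (\<Sum>k\<in>{0..<4}. (q k)\<^sup>2 / (d k - x)) + 1) = 0"
    by (simp add: algebra_simps)
  then have "is_secular_root x"
    using \<open>s \<noteq> 0\<close> dx by (simp add: is_secular_root_def)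
  then show thesis using vj that by blast
qed

text \<open>The scale \<open>a\<close> is left free so that normalized rows are covered
  directly.\<close>

lemma eigenvector_secular:
  assumes "is_secular_root x" "a \<noteq> 0"
  shows "eigenvector A (vec 4 (\<lambda>j. a * (q j / (d j - x)))) x"
proof -
  let ?v = "vec 4 (\<lambda>j. a * (q j / (d j - x)))"
  have dx: "d j \<noteq> x" if "j < 4" for j
    using assms that by (simp add: is_secular_root_def)
  have "(\<Sum>k\<in>{0..<4}. q k * ?v $ k) = a * (\<Sum>k\<in>{0..<4}. (q k)\<^sup>2 / (d k - x))"
    by (simp add: sum_distrib_left power2_eq_square mult.left_commute)
  then have s: "c * (\<Sum>k\<in>{0..<4}. q k * ?v $ k) = - a"
    using assms by (simp add: is_secular_root_def mult.left_commute)
  have "A *\<^sub>v ?v = x \<cdot>\<^sub>v ?v"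
  proof (rule eq_vecI)
    fix j assume "j < dim_vec (x \<cdot>\<^sub>v ?v)"
    then have j: "j < 4" by simp
    have "(A *\<^sub>v ?v) $ j = d j * ?v $ j + q j * (c * (\<Sum>k\<in>{0..<4}. q k * ?v $ k))"
      using index_A_mult_vec[of ?v j] j by (simp add: mult_ac)
    also have "\<dots> = x * ?v $ j"
      unfolding s using dx[OF j] j by (simp add: field_simps)
    finally show "(A *\<^sub>v ?v) $ j = (x \<cdot>\<^sub>v ?v) $ j" using j by simp
  qed (use A_carrier in simp)
  moreover have "?v $ 0 \<noteq> 0" using assms(2) q_nonzero[of 0] dx[of 0] by simp
  then have "?v \<noteq> 0\<^sub>v 4" by (metis index_zero_vec(1) zero_less_numeral)
  ultimately show ?thesis
    using A_carrier by (simp add: eigenvector_def)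
qed

lemma eigenvalue_iff: "eigenvalue A x \<longleftrightarrow> is_secular_root x"
  unfolding eigenvalue_def
  using eigenvectorE eigenvector_secular[of x 1] by (metis zero_neq_one)

lemma secular_poly_eq:
  assumes "\<forall>j<4. d j \<noteq> x"
  shows "secular_poly x = (x - d 0) * (x - d 1) * (x - d 2) * (x - d 3)
    * (1 + c * (\<Sum>k\<in>{0..<4}. (q k)\<^sup>2 / (d k - x)))"
proof -
  \<comment> \<open>Once the quotients have names,
    \<open>(q j)\<^sup>2 = - ((x - d j) * r j)\<close> turns the claim into a polynomial
    identity.\<close>
  define r where "r = (\<lambda>k. (q k)\<^sup>2 / (d k - x))"
  have "(q j)\<^sup>2 = - ((x - d j) * r j)" if "j < 4" for j
    using assms that by (simp add: r_def field_simps)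
  then have "(q 0)\<^sup>2 = - ((x - d 0) * r 0)" "(q 1)\<^sup>2 = - ((x - d 1) * r 1)"
    "(q 2)\<^sup>2 = - ((x - d 2) * r 2)" "(q 3)\<^sup>2 = - ((x - d 3) * r 3)"
    by simp_all
  then have "secular_poly x = (x - d 0) * (x - d 1) * (x - d 2) * (x - d 3)
      * (1 + c * (r 0 + r 1 + r 2 + r 3))"
    unfolding secular_poly_def by Groebner_Basis.algebra
  then show ?thesis by (simp add: sum_4 r_def)
qed

text \<open>At \<open>d j\<close> a single term survives: \<open>- c * (q j)\<^sup>2\<close> times
  the product of the differences \<open>d j - d k\<close> over \<open>k \<noteq> j\<close>. The same
  term governs the signs used below.\<close>

lemma secular_poly_nonzero: "j < 4 \<Longrightarrow> secular_poly (d j) \<noteq> 0"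
proof -
  assume j: "j < 4"
  have "\<forall>i<4. secular_poly (d i) \<noteq> 0"
    unfolding all_less_4 secular_poly_def
    using d_less c_pos q_nonzero[of 0] q_nonzero[of 1] q_nonzero[of 2] q_nonzero[of 3] by simp
  then show ?thesis using j by blast
qed

lemma is_secular_root_iff: "is_secular_root x \<longleftrightarrow> secular_poly x = 0"
proof (cases "\<forall>j<4. d j \<noteq> x")
  case True
  then have "(x - d 0) * (x - d 1) * (x - d 2) * (x - d 3) \<noteq> 0"
    unfolding all_less_4 by auto
  then show ?thesis
    using True by (auto simp: is_secular_root_def secular_poly_eq[OF True])
next
  case False
  then show ?thesis
    using secular_poly_nonzero by (auto simp: is_secular_root_def)
qed

text \<open>The signs of \<open>secular_poly\<close> at the \<open>d\<^sub>j\<close> alternate, so each of the intervals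
  \<open>(d\<^sub>j, d\<^sub>j\<^sub>+\<^sub>1)\<close> and \<open>(d\<^sub>3, \<infinity>)\<close> contains an eigenvalue.\<close>

lemma ex_secular_poly_pos: "\<exists>x>d 3. secular_poly x > 0"
proof -
  define T where "T = (\<Sum>k\<in>{0..<4}. (q k)\<^sup>2)"
  have T: "T \<ge> 0" by (simp add: T_def sum_nonneg)
  \<comment> \<open>With this choice every gap \<open>x - d j\<close> is at least
    \<open>c * T + 1\<close>, so the secular sum is bounded by
    \<open>c * T / (c * T + 1) < 1\<close> in absolute value.\<close>
  define x where "x = d 3 + c * T + 1"
  have cT: "c * T \<ge> 0" using T c_pos by simp
  have gap: "c * T + 1 \<le> x - d j" if "j < 4" for j
    using d_strict[of j 3] that by (cases "j = 3") (auto simp: x_def)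
  have pos: "x - d j > 0" if "j < 4" for j
    using gap[OF that] cT by simp
  have "(\<Sum>k\<in>{0..<4}. (q k)\<^sup>2 / (x - d k)) \<le> (\<Sum>k\<in>{0..<4}. (q k)\<^sup>2 / (c * T + 1))"
    using gap cT by (intro sum_mono divide_left_mono) (auto intro!: mult_pos_pos pos)
  also have "\<dots> = T / (c * T + 1)" by (simp add: T_def sum_divide_distrib)
  finally have "c * (\<Sum>k\<in>{0..<4}. (q k)\<^sup>2 / (x - d k)) \<le> c * (T / (c * T + 1))"
    by (rule mult_left_mono) (use c_pos in simp)
  also have "\<dots> < 1" using cT by simp
  finally have "1 + c * (\<Sum>k\<in>{0..<4}. - ((q k)\<^sup>2 / (x - d k))) > 0"
    by (simp add: sum_negf)
  moreover have "- ((q k)\<^sup>2 / (x - d k)) = (q k)\<^sup>2 / (d k - x)" for k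
    by (metis minus_diff_eq minus_divide_right)
  ultimately have "1 + c * (\<Sum>k\<in>{0..<4}. (q k)\<^sup>2 / (d k - x)) > 0" by simp
  moreover have "\<forall>j<4. d j \<noteq> x" using pos by force
  ultimately have "secular_poly x > 0"
    using pos[of 0] pos[of 1] pos[of 2] pos[of 3] by (simp add: secular_poly_eq)
  then show ?thesis using pos[of 3] by auto
qed

lemma ex_secular_roots:
  "\<exists>\<mu> :: nat \<Rightarrow> real. strict_mono_on {..<4} \<mu> \<and> (\<forall>i<4. secular_poly (\<mu> i) = 0)"
proof -
  have cont: "continuous_on X secular_poly" for X
    unfolding secular_poly_def by (intro continuous_intros)
  have qpos: "(q j)\<^sup>2 > 0" if "j < 4" for j using q_nonzero[OF that] by simp
  have pos: "secular_poly (d 0) > 0" "secular_poly (d 2) > 0"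
    and neg: "secular_poly (d 1) < 0" "secular_poly (d 3) < 0"
    unfolding secular_poly_def
    using d_less c_pos qpos[of 0] qpos[of 1] qpos[of 2] qpos[of 3]
    by (simp_all add: zero_less_mult_iff mult_less_0_iff)
  obtain b where b: "b > d 3" "secular_poly b > 0" using ex_secular_poly_pos by blast
  obtain m0 where m0: "d 0 \<le> m0" "m0 \<le> d 1" "secular_poly m0 = 0"
    using IVT2'[of secular_poly "d 1" 0 "d 0"] pos neg d_less cont by auto
  obtain m1 where m1: "d 1 \<le> m1" "m1 \<le> d 2" "secular_poly m1 = 0"
    using IVT'[of secular_poly "d 1" 0 "d 2"] pos neg d_less cont by auto
  obtain m2 where m2: "d 2 \<le> m2" "m2 \<le> d 3" "secular_poly m2 = 0"
    using IVT2'[of secular_poly "d 3" 0 "d 2"] pos neg d_less cont by auto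
  obtain m3 where m3: "d 3 \<le> m3" "m3 \<le> b" "secular_poly m3 = 0"
    using IVT'[of secular_poly "d 3" 0 b] pos neg b cont by auto
  \<comment> \<open>The intermediate value theorem gives closed intervals with common endpoints;
    excluding the shared ones makes the roots distinct.\<close>
  have "m0 \<noteq> d 1" "m1 \<noteq> d 2" "m2 \<noteq> d 3"
    using m0(3) m1(3) m2(3) secular_poly_nonzero[of 1] secular_poly_nonzero[of 2] secular_poly_nonzero[of 3] by auto
  then have less: "m0 < m1" "m1 < m2" "m2 < m3"
    using m0 m1 m2 m3 by auto
  define \<mu> where "\<mu> = (\<lambda>i::nat. [m0, m1, m2, m3] ! i)"
  have \<mu>: "\<mu> 0 = m0" "\<mu> 1 = m1" "\<mu> 2 = m2" "\<mu> 3 = m3" by (simp_all add: \<mu>_def)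
  have "strict_mono_on {..<4} \<mu>"
    using less by (intro strict_mono_on_lessThan_4) (simp_all only: \<mu>)
  moreover have "\<forall>i<4. secular_poly (\<mu> i) = 0"
    unfolding all_less_4 \<mu> using m0 m1 m2 m3 by simp
  ultimately show ?thesis by blast
qed

text \<open>A characteristic polynomial of degree 4 has at most four roots, so the four secular
  roots exhaust the spectrum.\<close>

lemma ex_ordered_eigenvalues: "\<exists>\<mu>. ordered_eigenvalues A \<mu>"
proof -
  obtain \<mu> :: "nat \<Rightarrow> real" where mono: "strict_mono_on {..<4} \<mu>" and root: "\<forall>i<4. secular_poly (\<mu> i) = 0"
    using ex_secular_roots by blast
  have deg: "degree (char_poly A) = 4" and "coeff (char_poly A) 4 = 1"
    using degree_monic_char_poly[OF A_carrier] by simp_all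
  then have nz: "char_poly A \<noteq> 0" by auto
  have ev: "{x. eigenvalue A x} = {x. poly (char_poly A) x = 0}"
    using eigenvalue_root_char_poly[OF A_carrier] by simp
  have "\<mu> ` {..<4} \<subseteq> {x. eigenvalue A x}"
    using root by (auto simp: eigenvalue_iff is_secular_root_iff)
  moreover have "card (\<mu> ` {..<4}) = 4"
    using mono by (simp add: card_image strict_mono_on_imp_inj_on)
  moreover have "finite {x. eigenvalue A x}" "card {x. eigenvalue A x} \<le> 4"
    unfolding ev using nz poly_roots_finite card_poly_roots_bound[OF nz] deg by auto
  ultimately have "\<mu> ` {..<4} = {x. eigenvalue A x}"
    by (intro card_seteq) auto
  then show ?thesis
    unfolding ordered_eigenvalues_def using mono by metis
qed

lemma char_poly_eqI:
  assumes "degree p = 4" "lead_coeff p = 1" "\<And>x. poly p x = secular_poly x"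
  shows "char_poly A = p"
proof -
  obtain \<mu> :: "nat \<Rightarrow> real" where mono: "strict_mono_on {..<4} \<mu>" and root: "\<forall>i<4. secular_poly (\<mu> i) = 0"
    using ex_secular_roots by blast
  show ?thesis
  \<comment> \<open>Equal leading coefficients push the degree of the difference below 4, so
    agreement at four distinct points is enough.\<close>
  proof (rule poly_eqI_degree_lead_coeff[of _ 4 _ "\<mu> ` {..<4}"])
    fix z assume "z \<in> \<mu> ` {..<4}"
    then have "secular_poly z = 0" using root by auto
    then show "poly (char_poly A) z = poly p z"
      using eigenvalue_root_char_poly[OF A_carrier] assms(3)
      by (simp add: eigenvalue_iff is_secular_root_iff)
  qed (use assms degree_monic_char_poly[OF A_carrier] mono
      in \<open>auto simp: card_image strict_mono_on_imp_inj_on\<close>)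
qed

lemma gram_pos:
  assumes "is_secular_root x"
  shows "gram x > 0"
proof -
  have "(q k)\<^sup>2 / (d k - x)\<^sup>2 > 0" if "k < 4" for k
    using assms that q_nonzero[OF that] by (simp add: is_secular_root_def)
  then show ?thesis unfolding gram_def by (intro sum_pos) (auto simp: lessThan_empty_iff)
qed

text \<open>By partial fractions, \<open>x - y\<close> times the inner product is the difference of
  the secular sums at \<open>x\<close> and \<open>y\<close>, and both sums equal
  \<open>- 1 / c\<close>.\<close>

lemma secular_roots_orthogonal:
  assumes "is_secular_root x" "is_secular_root y" "x \<noteq> y"
  shows "(\<Sum>k\<in>{0..<4}. (q k / (d k - x)) * (q k / (d k - y))) = 0"
proof -
  let ?f = "\<lambda>x. (\<Sum>k\<in>{0..<4}. (q k)\<^sup>2 / (d k - x))"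
  have "(x - y) * (\<Sum>k\<in>{0..<4}. (q k / (d k - x)) * (q k / (d k - y))) = ?f x - ?f y"
    unfolding sum_distrib_left sum_subtractf[symmetric]
  proof (intro sum.cong refl)
    fix k :: nat assume "k \<in> {0..<4}"
    then have "d k \<noteq> x" "d k \<noteq> y" using assms by (auto simp: is_secular_root_def)
    then show "(x - y) * (q k / (d k - x) * (q k / (d k - y))) = (q k)\<^sup>2 / (d k - x) - (q k)\<^sup>2 / (d k - y)"
      by (simp add: diff_frac_eq power2_eq_square algebra_simps)
  qed
  moreover have "c * ?f x = c * ?f y" using assms by (simp add: is_secular_root_def)
  ultimately show ?thesis using assms(3) c_pos by simp
qed

text \<open>This guarantees that the claims about every admissible \<open>Q\<close> are not
  vacuous.\<close>

lemma ex_orthogonal_eigenbasis: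
  "\<exists>Q \<nu>. Q \<in> carrier_mat 4 4 \<and> Q * transpose_mat Q = 1\<^sub>m 4 \<and> transpose_mat Q * Q = 1\<^sub>m 4 \<and>
     mono_on {..<4} \<nu> \<and> (\<forall>i<4. eigenvector A (row Q i) (\<nu> i))"
proof -
  obtain \<mu> :: "nat \<Rightarrow> real" where mono: "strict_mono_on {..<4} \<mu>" and root: "\<And>i. i < 4 \<Longrightarrow> is_secular_root (\<mu> i)"
    using ex_secular_roots is_secular_root_iff by blast
  define a where "a = (\<lambda>i. 1 / sqrt (gram (\<mu> i)))"
  define Q where "Q = mat 4 4 (\<lambda>(i, j). a i * (q j / (d j - \<mu> i)))"
  have Q: "Q \<in> carrier_mat 4 4" by (simp add: Q_def)
  have row: "row Q i = vec 4 (\<lambda>j. a i * (q j / (d j - \<mu> i)))" if "i < 4" for i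
    using that by (intro eq_vecI) (simp_all add: Q_def)
  have ev: "eigenvector A (row Q i) (\<mu> i)" if "i < 4" for i
    unfolding row[OF that] using gram_pos[OF root[OF that]]
    by (intro eigenvector_secular root that) (simp add: a_def)
  have "Q * transpose_mat Q = 1\<^sub>m 4"
  proof (rule eq_matI)
    fix i j assume "i < dim_row (1\<^sub>m 4 :: real mat)" "j < dim_col (1\<^sub>m 4 :: real mat)"
    then have ij: "i < 4" "j < 4" by simp_all
    have "(Q * transpose_mat Q) $$ (i, j) = (\<Sum>k\<in>{0..<4}. Q $$ (i, k) * Q $$ (j, k))"
      using Q ij by (simp add: scalar_prod_def)
    also have "\<dots> = a i * a j * (\<Sum>k\<in>{0..<4}. (q k / (d k - \<mu> i)) * (q k / (d k - \<mu> j)))"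
      using ij unfolding sum_distrib_left by (intro sum.cong) (simp_all add: Q_def)
    also have "\<dots> = (if i = j then 1 else 0)"
    proof (cases "i = j")
      case True
      have "(\<Sum>k\<in>{0..<4}. (q k / (d k - \<mu> i)) * (q k / (d k - \<mu> j))) = gram (\<mu> i)"
        using True by (simp add: gram_def lessThan_atLeast0 power2_eq_square)
      then show ?thesis
        using True gram_pos[OF root[OF ij(1)]] by (simp add: a_def)
    next
      case False
      then have "\<mu> i \<noteq> \<mu> j"
        using mono ij by (metis inj_onD lessThan_iff strict_mono_on_imp_inj_on)
      then show ?thesis
        using secular_roots_orthogonal[OF root[OF ij(1)] root[OF ij(2)]] False by simp
    qed
    finally show "(Q * transpose_mat Q) $$ (i, j) = 1\<^sub>m 4 $$ (i, j)" using ij by simp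
  qed (simp_all add: Q_def)
  moreover from this have "transpose_mat Q * Q = 1\<^sub>m 4"
    using Q mat_mult_left_right_inverse[of Q 4 "transpose_mat Q"] by simp
  moreover have "mono_on {..<4} \<mu>"
    using mono by (rule strict_mono_on_imp_mono_on)
  ultimately show ?thesis using Q ev by blast
qed

text \<open>Each row is a multiple of the explicit eigenvector for \<open>\<nu> i\<close>, and unit
  length fixes the factor up to sign. What remains is \<open>\<nu> = \<mu>\<close>: an injective
  \<open>\<nu>\<close> fills the four-element spectrum, and an increasing enumeration of it is
  unique.\<close>

lemma orthogonal_eigenbasis_entries:
  assumes Q: "Q \<in> carrier_mat 4 4" and orth: "Q * transpose_mat Q = 1\<^sub>m 4"
    and mono: "mono_on {..<4} \<nu>" and ev: "\<forall>i<4. eigenvector A (row Q i) (\<nu> i)"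
    and \<mu>: "ordered_eigenvalues A \<mu>" and i: "i < 4"
  shows "\<exists>\<epsilon>\<in>{1, - 1}. \<forall>j<4. Q $$ (i, j) = \<epsilon> * (q j / (d j - \<mu> i) * gram (\<mu> i) powr (- 1/2))"
proof -
  have "\<forall>i<4. \<exists>a. is_secular_root (\<nu> i) \<and> (\<forall>j<4. Q $$ (i, j) = a * (q j / (d j - \<nu> i)))"
  proof (intro allI impI)
    fix i :: nat assume i: "i < 4"
    obtain a where "is_secular_root (\<nu> i)" "\<And>j. j < 4 \<Longrightarrow> row Q i $ j = a * (q j / (d j - \<nu> i))"
      using eigenvectorE ev i by metis
    then show "\<exists>a. is_secular_root (\<nu> i) \<and> (\<forall>j<4. Q $$ (i, j) = a * (q j / (d j - \<nu> i)))"
      using Q i by auto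
  qed
  then obtain a where root: "\<And>i. i < 4 \<Longrightarrow> is_secular_root (\<nu> i)"
    and entry: "\<And>i j. i < 4 \<Longrightarrow> j < 4 \<Longrightarrow> Q $$ (i, j) = a i * (q j / (d j - \<nu> i))"
    by metis
  have gram: "a i * a j * (\<Sum>k\<in>{0..<4}. (q k / (d k - \<nu> i)) * (q k / (d k - \<nu> j))) = (if i = j then 1 else 0)"
    if ij: "i < 4" "j < 4" for i j
  proof -
    have "(Q * transpose_mat Q) $$ (i, j) = (\<Sum>k\<in>{0..<4}. Q $$ (i, k) * Q $$ (j, k))"
      using Q ij by (simp add: scalar_prod_def)
    also have "\<dots> = a i * a j * (\<Sum>k\<in>{0..<4}. (q k / (d k - \<nu> i)) * (q k / (d k - \<nu> j)))"
      using ij unfolding sum_distrib_left by (intro sum.cong) (simp_all add: entry)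
    finally show ?thesis using orth ij by simp
  qed
  have norm: "(a i)\<^sup>2 * gram (\<nu> i) = 1" if "i < 4" for i
    using gram[OF that that] by (simp add: gram_def lessThan_atLeast0 power2_eq_square)
  \<comment> \<open>Rows with equal eigenvalues would be nonzero multiples of one vector, with inner
    product \<open>a i * a j * gram (\<nu> j) \<noteq> 0\<close>.\<close>
  have inj: "inj_on \<nu> {..<4}"
  proof (rule inj_onI)
    fix i j :: nat assume ij: "i \<in> {..<4}" "j \<in> {..<4}" "\<nu> i = \<nu> j"
    have "a i \<noteq> 0" "a j \<noteq> 0" using norm[of i] norm[of j] ij by auto
    moreover have "a i * a j * gram (\<nu> j) = (if i = j then 1 else 0)"
      using gram[of i j] ij by (simp add: gram_def lessThan_atLeast0 power2_eq_square)
    ultimately show "i = j"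
      using gram_pos[OF root[of j]] ij by (auto split: if_splits)
  qed
  then have smono: "strict_mono_on {..<4} \<nu>"
    using mono by (auto simp: monotone_on_def inj_on_def order_less_le)
  have mono\<mu>: "strict_mono_on {..<4} \<mu>" and img: "{x. eigenvalue A x} = \<mu> ` {..<4}"
    using \<mu> by (auto simp: ordered_eigenvalues_def)
  have "\<nu> ` {..<4} \<subseteq> \<mu> ` {..<4}"
    unfolding img[symmetric] using root by (auto simp: eigenvalue_iff)
  then have "\<nu> ` {..<4} = \<mu> ` {..<4}"
    using inj card_image[OF inj] card_image_le[of "{..<4}" \<mu>] by (intro card_seteq) auto
  then have "\<nu> i = \<mu> i"
    using strict_mono_on_image_unique[OF smono mono\<mu> _ i] by blast
  have g: "gram (\<nu> i) > 0" using gram_pos root i by blast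
  have powr: "gram (\<nu> i) powr (- 1/2) = 1 / sqrt (gram (\<nu> i))"
    using g by (simp add: powr_minus_divide powr_half_sqrt)
  have "(a i * sqrt (gram (\<nu> i)))\<^sup>2 = 1"
    using norm[OF i] g by (simp add: power_mult_distrib)
  then have "a i * sqrt (gram (\<nu> i)) \<in> {1, - 1}"
    by (simp add: power2_eq_1_iff)
  moreover have "Q $$ (i, j) = (a i * sqrt (gram (\<nu> i))) * (q j / (d j - \<nu> i) * gram (\<nu> i) powr (- 1/2))"
    if "j < 4" for j
    using entry[OF i that] g unfolding powr by simp
  ultimately show ?thesis
    unfolding \<open>\<nu> i = \<mu> i\<close>[symmetric] by blast
qed

end

section \<open>The two DCT halves\<close>

lemma cos_power2_half: "(cos t)\<^sup>2 = (1 + cos (2 * t)) / 2" for t :: real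
  by (simp add: cos_double_cos)

lemma sqrt_2_bounds: "1 < sqrt 2" "sqrt 2 < 2"
  by (simp_all add: real_less_rsqrt real_less_lsqrt)

lemma cos_pi_8: "cos (pi / 8) = sqrt (2 + sqrt 2) / 2"
proof -
  have "(2 * cos (pi / 8))\<^sup>2 = 2 + sqrt 2"
    using cos_power2_half[of "pi / 8"] by (simp add: power_mult_distrib cos_45)
  moreover have "cos (pi / 8) \<ge> 0" by (rule cos_ge_zero) simp_all
  ultimately show ?thesis using real_sqrt_unique[of "2 * cos (pi / 8)"] by simp
qed

lemma cos_3_pi_8: "cos (3 * pi / 8) = sqrt (2 - sqrt 2) / 2"
proof -
  have "2 * (3 * pi / 8) = pi - pi / 4" by simp
  then have "cos (2 * (3 * pi / 8)) = - (sqrt 2 / 2)"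
    by (simp only: cos_pi_minus cos_45)
  then have "(2 * cos (3 * pi / 8))\<^sup>2 = 2 - sqrt 2"
    using cos_power2_half[of "3 * pi / 8"] by (simp add: power_mult_distrib)
  moreover have "cos (3 * pi / 8) \<ge> 0" by (rule cos_ge_zero) simp_all
  ultimately show ?thesis using real_sqrt_unique[of "2 * cos (3 * pi / 8)"] by simp
qed

text \<open>This form of the listed radicals suits the double-angle formula, which turns the square
  of \<open>cos (pi * j / 8)\<close> from the first DCT column into
  \<open>(4 - lam Sym j) / 4\<close>.\<close>

lemma lam_Sym_cos: "\<forall>j<4. cos (pi * real j / 4) = 1 - lam Sym j / 2"
proof -
  have "pi * 3 / 4 = pi - pi / 4" by simp
  then have "cos (pi * 3 / 4) = - (sqrt 2 / 2)" by (simp only: cos_pi_minus cos_45)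
  then show ?thesis unfolding all_less_4 by (simp add: cos_45 diff_divide_distrib add_divide_distrib)
qed

lemma lam_Asym_cos: "\<forall>j<4. cos (pi * (2 * real j + 1) / 8) = 1 - lam Asym j / 2"
proof -
  have "cos (pi * 5 / 8) = - cos (3 * pi / 8)" "cos (pi * 7 / 8) = - cos (pi / 8)"
    unfolding cos_pi_minus[symmetric] by (rule arg_cong[of _ _ cos], simp)+
  moreover have "cos (pi * 3 / 8) = cos (3 * pi / 8)" by (simp add: mult.commute)
  ultimately show ?thesis
    unfolding all_less_4 by (simp add: cos_pi_8 cos_3_pi_8 diff_divide_distrib add_divide_distrib)
qed

lemma qvec_Sym_power2:
  assumes "j < 4"
  shows "(qvec Sym $ j)\<^sup>2 = (dct_beta j)\<^sup>2 * ((4 - lam Sym j) / 8)"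
proof -
  have "qvec Sym $ j = sqrt (1/2) * dct_beta j * cos (pi * real j / 8)"
    using assms by (simp add: qvec_def dct_II_def)
  then have "(qvec Sym $ j)\<^sup>2 = (dct_beta j)\<^sup>2 * ((cos (pi * real j / 8))\<^sup>2 / 2)"
    by (simp add: power_mult_distrib real_sqrt_divide power_divide)
  also have "(cos (pi * real j / 8))\<^sup>2 = (1 + cos (pi * real j / 4)) / 2"
    unfolding cos_power2_half by simp
  also have "cos (pi * real j / 4) = 1 - lam Sym j / 2" using lam_Sym_cos assms by blast
  finally show ?thesis by (simp add: field_simps del: lam.simps)
qed

lemma qvec_Asym_power2:
  assumes "j < 4"
  shows "(qvec Asym $ j)\<^sup>2 = (4 - lam Asym j) / 8"
proof -
  have "qvec Asym $ j = sqrt (1/2) * cos (pi * (2 * real j + 1) / 16)"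
    using assms by (simp add: qvec_def dct_IV_def)
  then have "(qvec Asym $ j)\<^sup>2 = (cos (pi * (2 * real j + 1) / 16))\<^sup>2 / 2"
    by (simp add: power_mult_distrib real_sqrt_divide power_divide)
  also have "(cos (pi * (2 * real j + 1) / 16))\<^sup>2 = (1 + cos (pi * (2 * real j + 1) / 8)) / 2"
    unfolding cos_power2_half by simp
  also have "cos (pi * (2 * real j + 1) / 8) = 1 - lam Asym j / 2" using lam_Asym_cos assms by blast
  finally show ?thesis by (simp add: field_simps del: lam.simps)
qed

lemma sqrt_2_plus_minus:
  "0 < sqrt (2 - sqrt 2)" "sqrt (2 - sqrt 2) < sqrt (2 + sqrt 2)" "sqrt (2 + sqrt 2) < 2"
  using sqrt_2_bounds by (simp_all add: real_less_lsqrt)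

lemma lam_strict: "lam x 0 < lam x 1" "lam x 1 < lam x 2" "lam x 2 < lam x 3"
  using sqrt_2_bounds sqrt_2_plus_minus by (cases x; simp)+

lemma lam_less_4: "j < 4 \<Longrightarrow> lam x j < 4"
proof -
  assume j: "j < 4"
  have "lam x 3 < 4" using sqrt_2_bounds sqrt_2_plus_minus by (cases x) simp_all
  then have "\<forall>j<4. lam x j < 4"
    unfolding all_less_4 using lam_strict[of x] by linarith
  then show "lam x j < 4" using j by blast
qed

text \<open>Read off from the squares, where \<open>lam x j < 4\<close> suffices; the zeros of the
  cosines never have to be located.\<close>

lemma qvec_nonzero: "j < 4 \<Longrightarrow> qvec x $ j \<noteq> 0"
proof -
  assume j: "j < 4"
  have "dct_beta j \<noteq> 0" by (simp add: dct_beta_def)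
  then have "(qvec x $ j)\<^sup>2 \<noteq> 0"
    using qvec_Sym_power2[OF j] qvec_Asym_power2[OF j] lam_less_4[OF j, of x] by (cases x) auto
  then show ?thesis by simp
qed

lemma rank_one_update_Gmat:
  assumes "0 < \<rho>" "\<rho> < 1"
  shows "rank_one_update (dvals x \<rho>) (\<lambda>j. qvec x $ j) (\<rho> * (1 - \<rho>)) (Gmat x \<rho>)"
proof
  show "dvals x \<rho> 0 < dvals x \<rho> 1" "dvals x \<rho> 1 < dvals x \<rho> 2" "dvals x \<rho> 2 < dvals x \<rho> 3"
    using assms lam_strict[of x] by (simp_all add: dvals_def del: lam.simps)
qed (use assms qvec_nonzero in \<open>simp_all add: Gmat_def\<close>)

section \<open>The two characteristic polynomials\<close>

lemma secular_poly_Sym: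
  assumes "0 < \<rho>" "\<rho> < 1"
  shows "poly (quartic \<rho>) x = rank_one_update.secular_poly (dvals Sym \<rho>) (\<lambda>j. qvec Sym $ j) (\<rho> * (1 - \<rho>)) x"
proof -
  interpret rank_one_update "dvals Sym \<rho>" "\<lambda>j. qvec Sym $ j" "\<rho> * (1 - \<rho>)" "Gmat Sym \<rho>"
    using assms by (rule rank_one_update_Gmat)
  define r where "r = sqrt 2"
  have r: "r\<^sup>2 = 2" by (simp add: r_def)
  \<comment> \<open>Centering at \<open>1 + \<rho>^2\<close> turns \<open>x - d j\<close> into
    \<open>y + \<rho> * (2 - lam j)\<close>. The offsets \<open>2 - lam j\<close> are
    \<open>2\<close>, \<open>r\<close>, \<open>0\<close>, \<open>- r\<close>, so the conjugate
    factors pair up and only \<open>r\<^sup>2 = 2\<close> is left.\<close>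
  define y where "y = x - 1 - \<rho>\<^sup>2"
  have xd: "x - dvals Sym \<rho> 0 = y + 2 * \<rho>" "x - dvals Sym \<rho> 1 = y + \<rho> * r"
    "x - dvals Sym \<rho> 2 = y" "x - dvals Sym \<rho> 3 = y - \<rho> * r"
    by (simp_all add: dvals_def r_def y_def power2_eq_square algebra_simps)
  have Q: "(qvec Sym $ 0)\<^sup>2 = 2 / 8" "(qvec Sym $ 1)\<^sup>2 = (2 + r) / 8"
    "(qvec Sym $ 2)\<^sup>2 = 2 / 8" "(qvec Sym $ 3)\<^sup>2 = (2 - r) / 8"
    by (simp_all add: qvec_Sym_power2 dct_beta_def r_def power_divide)
  have a: "(y + \<rho> * r) * (y - \<rho> * r) = y\<^sup>2 - r\<^sup>2 * \<rho>\<^sup>2"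
    by Groebner_Basis.algebra
  have b: "(2 + r) * (y - \<rho> * r) + (2 - r) * (y + \<rho> * r) = 4 * y - 2 * r\<^sup>2 * \<rho>"
    by Groebner_Basis.algebra
  have "8 * secular_poly x = 8 * (y * (y + 2 * \<rho>) * ((y + \<rho> * r) * (y - \<rho> * r)))
    - \<rho> * (1 - \<rho>) * ((2 * y + 2 * (y + 2 * \<rho>)) * ((y + \<rho> * r) * (y - \<rho> * r))
       + ((2 + r) * (y - \<rho> * r) + (2 - r) * (y + \<rho> * r)) * (y * (y + 2 * \<rho>)))"
    unfolding secular_poly_def xd Q by (simp add: algebra_simps add_divide_distrib diff_divide_distrib)
  also have "\<dots> = 8 * poly (quartic \<rho>) x"
    unfolding a b r unfolding quartic_def y_def
    by (simp only: poly_pCons poly_0) Groebner_Basis.algebra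
  finally show ?thesis by simp
qed

lemma secular_poly_Asym:
  assumes "0 < \<rho>" "\<rho> < 1"
  shows "poly (quartic (- \<rho>)) x = rank_one_update.secular_poly (dvals Asym \<rho>) (\<lambda>j. qvec Asym $ j) (\<rho> * (1 - \<rho>)) x"
proof -
  interpret rank_one_update "dvals Asym \<rho>" "\<lambda>j. qvec Asym $ j" "\<rho> * (1 - \<rho>)" "Gmat Asym \<rho>"
    using assms by (rule rank_one_update_Gmat)
  define r where "r = sqrt 2"
  define s where "s = sqrt (2 + r)"
  define t where "t = sqrt (2 - r)"
  have r: "r\<^sup>2 = 2" and s: "s\<^sup>2 = 2 + r" and t: "t\<^sup>2 = 2 - r"
    using sqrt_2_bounds by (simp_all add: r_def s_def t_def)
  \<comment> \<open>The offsets are now \<open>s\<close>, \<open>t\<close>, \<open>- t\<close>,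
    \<open>- s\<close>. Pairing index 0 with 3 and 1 with 2 removes \<open>s\<close> and
    \<open>t\<close> in favour of \<open>r\<close>.\<close>
  define y where "y = x - 1 - \<rho>\<^sup>2"
  have xd: "x - dvals Asym \<rho> 0 = y + \<rho> * s" "x - dvals Asym \<rho> 1 = y + \<rho> * t"
    "x - dvals Asym \<rho> 2 = y - \<rho> * t" "x - dvals Asym \<rho> 3 = y - \<rho> * s"
    by (simp_all add: dvals_def r_def s_def t_def y_def power2_eq_square algebra_simps)
  have Q: "(qvec Asym $ 0)\<^sup>2 = (2 + s) / 8" "(qvec Asym $ 1)\<^sup>2 = (2 + t) / 8"
    "(qvec Asym $ 2)\<^sup>2 = (2 - t) / 8" "(qvec Asym $ 3)\<^sup>2 = (2 - s) / 8"
    by (simp_all add: qvec_Asym_power2 s_def t_def r_def)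
  define a where "a = y\<^sup>2 - \<rho>\<^sup>2 * (2 + r)"
  define b where "b = y\<^sup>2 - \<rho>\<^sup>2 * (2 - r)"
  have a: "(y + \<rho> * s) * (y - \<rho> * s) = a" unfolding a_def using s by Groebner_Basis.algebra
  have b: "(y + \<rho> * t) * (y - \<rho> * t) = b" unfolding b_def using t by Groebner_Basis.algebra
  have a': "(2 + s) * (y - \<rho> * s) + (2 - s) * (y + \<rho> * s) = 4 * y - 2 * \<rho> * (2 + r)"
    using s by Groebner_Basis.algebra
  have b': "(2 + t) * (y - \<rho> * t) + (2 - t) * (y + \<rho> * t) = 4 * y - 2 * \<rho> * (2 - r)"
    using t by Groebner_Basis.algebra
  \<comment> \<open>Replacing \<open>r\<close> by \<open>- r\<close> swaps \<open>a\<close> and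
    \<open>b\<close>, so these symmetric combinations involve \<open>r\<close> only through
    \<open>r\<^sup>2\<close>, and the last irrationality disappears.\<close>
  have ab: "a * b = y ^ 4 - 4 * \<rho>\<^sup>2 * y\<^sup>2 + \<rho> ^ 4 * (4 - r\<^sup>2)"
    unfolding a_def b_def by Groebner_Basis.algebra
  have ab': "(4 * y - 2 * \<rho> * (2 + r)) * b + (4 * y - 2 * \<rho> * (2 - r)) * a
      = 8 * y ^ 3 - 16 * y * \<rho>\<^sup>2 - 8 * \<rho> * y\<^sup>2 + 16 * \<rho> ^ 3 - 4 * \<rho> ^ 3 * r\<^sup>2"
    unfolding a_def b_def by Groebner_Basis.algebra
  have "8 * secular_poly x = 8 * (((y + \<rho> * s) * (y - \<rho> * s)) * ((y + \<rho> * t) * (y - \<rho> * t)))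
    - \<rho> * (1 - \<rho>) * (((2 + s) * (y - \<rho> * s) + (2 - s) * (y + \<rho> * s)) * ((y + \<rho> * t) * (y - \<rho> * t))
       + ((2 + t) * (y - \<rho> * t) + (2 - t) * (y + \<rho> * t)) * ((y + \<rho> * s) * (y - \<rho> * s)))"
    unfolding secular_poly_def xd Q by (simp add: algebra_simps add_divide_distrib diff_divide_distrib)
  also have "\<dots> = 8 * poly (quartic (- \<rho>)) x"
    unfolding a b a' b' ab ab' r unfolding quartic_def y_def
    by (simp only: poly_pCons poly_0) Groebner_Basis.algebra
  finally show ?thesis by simp
qed

lemma degree_quartic: "degree (quartic \<rho>) = 4" and lead_coeff_quartic: "lead_coeff (quartic \<rho>) = 1"
  by (simp_all add: quartic_def)

lemma char_poly_Gmat: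
  assumes "0 < \<rho>" "\<rho> < 1"
  shows "char_poly (Gmat Sym \<rho>) = quartic \<rho>" "char_poly (Gmat Asym \<rho>) = quartic (- \<rho>)"
  using rank_one_update.char_poly_eqI[OF rank_one_update_Gmat[OF assms]]
    secular_poly_Sym[OF assms] secular_poly_Asym[OF assms] degree_quartic lead_coeff_quartic
  by blast+

section \<open>Radical expressions for the entries, and the theorem\<close>

lemma expressible_dvals: "j < 4 \<Longrightarrow> expressible_in_radicals \<rho> (dvals x \<rho> j)"
  and expressible_qvec: "j < 4 \<Longrightarrow> expressible_in_radicals \<rho> (qvec x $ j)"
proof -
  assume j: "j < 4"
  have "\<forall>j<4. expressible_in_radicals \<rho> (lam x j)"
    unfolding all_less_4 by (cases x) (auto intro!: expressible_intros)
  then have lam: "expressible_in_radicals \<rho> (lam x j)" using j by blast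
  show "expressible_in_radicals \<rho> (dvals x \<rho> j)"
    unfolding dvals_def by (intro expressible_intros lam)
  have beta: "expressible_in_radicals \<rho> (dct_beta j)"
    by (simp add: dct_beta_def expressible_intros)
  \<comment> \<open>The square is rational in \<open>lam x j\<close> and \<open>dct_beta j\<close>;
    taking its root avoids evaluating the cosines in \<open>qvec\<close>.\<close>
  have "expressible_in_radicals \<rho> ((qvec x $ j)\<^sup>2)"
    using lam by (cases x) (simp_all add: qvec_Sym_power2 qvec_Asym_power2 j expressible_intros beta del: lam.simps)
  then show "expressible_in_radicals \<rho> (qvec x $ j)" by (rule expressible_if_power2)
qed

lemma expressible_powr_neg_half:
  assumes "expressible_in_radicals \<rho> a" "a \<ge> 0"
  shows "expressible_in_radicals \<rho> (a powr (- 1/2))"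
proof -
  have "a powr (- 1/2) = 1 / sqrt a"
    using assms(2) by (simp add: powr_minus_divide powr_half_sqrt)
  then show ?thesis using assms(1) by (simp add: expressible_intros)
qed

theorem mainTheorem4:
  fixes \<rho> :: real
  assumes "0 < \<rho>" and "\<rho> < 1"
  shows
    "(\<forall>j<4. (qvec Sym $ j)\<^sup>2 = (dct_beta j)\<^sup>2 * ((4 - lam Sym j) / 8)) \<and>
     (\<forall>j<4. (qvec Asym $ j)\<^sup>2 = (4 - lam Asym j) / 8) \<and>
     char_poly (Gmat Sym \<rho>) = quartic \<rho> \<and>
     char_poly (Gmat Asym \<rho>) = quartic (- \<rho>) \<and>
     (\<forall>x. (\<exists>\<mu>. ordered_eigenvalues (Gmat x \<rho>) \<mu>) \<and>
          (\<exists>Q. is_Qmat x \<rho> Q) \<and>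
          (\<forall>Q. is_Qmat x \<rho> Q \<longrightarrow>
             (\<forall>\<mu>. ordered_eigenvalues (Gmat x \<rho>) \<mu> \<longrightarrow>
                (\<forall>i<4. (\<forall>j<4. dvals x \<rho> j - \<mu> i \<noteq> 0) \<and>
                   (\<exists>\<epsilon>\<in>{1, - 1}. \<forall>j<4. Q $$ (i, j) =
                      \<epsilon> * (qvec x $ j / (dvals x \<rho> j - \<mu> i) *
                        (\<Sum>k<4. (qvec x $ k)\<^sup>2 / (dvals x \<rho> k - \<mu> i)\<^sup>2) powr (- 1/2))))) \<and>
             (\<exists>\<theta>. givens_factorization Q \<theta>) \<and>
             (\<forall>i<4. \<forall>j<4. expressible_in_radicals \<rho> (Q $$ (i, j))) \<and>
             (\<exists>\<theta>. givens_factorization Q \<theta> \<and>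
                (\<forall>k\<in>{1..6}. expressible_in_radicals \<rho> (cos (\<theta> k)) \<and>
                             expressible_in_radicals \<rho> (sin (\<theta> k))))))"
proof (intro conjI allI impI)
  fix x
  interpret rank_one_update "dvals x \<rho>" "\<lambda>j. qvec x $ j" "\<rho> * (1 - \<rho>)" "Gmat x \<rho>"
    using assms by (rule rank_one_update_Gmat)
  show ex\<mu>: "\<exists>\<mu>. ordered_eigenvalues (Gmat x \<rho>) \<mu>"
    by (rule ex_ordered_eigenvalues)
  show "\<exists>Q. is_Qmat x \<rho> Q"
    unfolding is_Qmat_def using ex_orthogonal_eigenbasis by blast
  fix Q assume "is_Qmat x \<rho> Q"
  then obtain \<nu> where Q: "Q \<in> carrier_mat 4 4" "Q * transpose_mat Q = 1\<^sub>m 4" "transpose_mat Q * Q = 1\<^sub>m 4"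
    and \<nu>: "mono_on {..<4} \<nu>" "\<forall>i<4. eigenvector (Gmat x \<rho>) (row Q i) (\<nu> i)"
    unfolding is_Qmat_def by blast
  have root: "is_secular_root (\<mu> i)" if "ordered_eigenvalues (Gmat x \<rho>) \<mu>" "i < 4" for \<mu> i
    using that eigenvalue_iff by (auto simp: ordered_eigenvalues_def)
  show "dvals x \<rho> j - \<mu> i \<noteq> 0"
    if "ordered_eigenvalues (Gmat x \<rho>) \<mu>" "i < 4" "j < 4" for \<mu> i j
    using root[OF that(1,2)] that(3) by (simp add: is_secular_root_def)
  have entries: "\<exists>\<epsilon>\<in>{1, - 1}. \<forall>j<4. Q $$ (i, j) =
      \<epsilon> * (qvec x $ j / (dvals x \<rho> j - \<mu> i) * gram (\<mu> i) powr (- 1/2))"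
    if "ordered_eigenvalues (Gmat x \<rho>) \<mu>" "i < 4" for \<mu> i
    by (rule orthogonal_eigenbasis_entries[OF Q(1,2) \<nu> that])
  then show "\<exists>\<epsilon>\<in>{1, - 1}. \<forall>j<4. Q $$ (i, j) = \<epsilon> * (qvec x $ j / (dvals x \<rho> j - \<mu> i) *
      (\<Sum>k<4. (qvec x $ k)\<^sup>2 / (dvals x \<rho> k - \<mu> i)\<^sup>2) powr (- 1/2))"
    if "ordered_eigenvalues (Gmat x \<rho>) \<mu>" "i < 4" for \<mu> i
    using that unfolding gram_def by blast
  show E: "expressible_in_radicals \<rho> (Q $$ (i, j))" if ij: "i < 4" "j < 4" for i j
  proof -
    obtain \<mu> where \<mu>: "ordered_eigenvalues (Gmat x \<rho>) \<mu>" using ex\<mu> by blast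
    have "poly (char_poly (Gmat x \<rho>)) (\<mu> i) = 0"
      using root[OF \<mu> ij(1)] eigenvalue_iff eigenvalue_root_char_poly[OF A_carrier] by blast
    \<comment> \<open>From here the two halves are treated alike, since a root of either quartic is
      expressible.\<close>
    then have "poly (quartic \<rho>) (\<mu> i) = 0 \<or> poly (quartic (- \<rho>)) (\<mu> i) = 0"
      using char_poly_Gmat[OF assms] by (cases x) simp_all
    then have E\<mu>: "expressible_in_radicals \<rho> (\<mu> i)"
      by (auto elim!: expressible_quartic_root intro: expressible_intros)
    have "expressible_in_radicals \<rho> (gram (\<mu> i))"
      unfolding gram_def by (intro expressible_intros expressible_dvals expressible_qvec E\<mu>) simp_all
    then have "expressible_in_radicals \<rho> (gram (\<mu> i) powr (- 1/2))"
      using gram_pos[OF root[OF \<mu> ij(1)]] by (simp only: expressible_powr_neg_half less_imp_le)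
    then have "expressible_in_radicals \<rho> (qvec x $ j / (dvals x \<rho> j - \<mu> i) * gram (\<mu> i) powr (- 1/2))"
      using ij by (intro expressible_intros expressible_dvals expressible_qvec E\<mu>)
    then show ?thesis
      using entries[OF \<mu> ij(1)] ij(2) expressible_arith(5) by fastforce
  qed
  show factors: "\<exists>\<theta>. givens_factorization Q \<theta> \<and>
      (\<forall>k\<in>{1..6}. expressible_in_radicals \<rho> (cos (\<theta> k)) \<and> expressible_in_radicals \<rho> (sin (\<theta> k)))"
    using Q E by (intro expressible_givens_factorization) blast+
  then show "\<exists>\<theta>. givens_factorization Q \<theta>" by blast
qed (use qvec_Sym_power2 qvec_Asym_power2 char_poly_Gmat[OF assms] in blast)+

end
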